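(* Let $d\geq 2$ be a constant and $p\in[1,\infty)\setminus 2\mathbb{Z}$ a constant. Any data structure that solves the $\ell_p$-subspace sketch problem for dimension $d$ and accuracy parameter $\varepsilon$ requires $\Omega(\varepsilon^{-\frac{2(d-1)}{d+2p}})$ bits of space; that is, there is a constant $c>0$ depending only on $d,p$ such that for all sufficiently small $\varepsilon>0$, any such data structure must use at least $c\,\varepsilon^{-\frac{2(d-1)}{d+2p}}$ bits on some input.
   Context: The $\ell_p$-subspace sketch problem: given an $n\times d$ matrix $A$ (entries specified by $O(\log(nd))$ bits) and accuracy $\varepsilon>0$, one must build a data structure $Q$ (depending only on $A$ and $\varepsilon$, possibly randomized) such that with constant probability, simultaneously for all $x\in\mathbb{R}^d$, $Q(x)=(1\pm\varepsilon)\|Ax\|_p^p$, where $\|Ax\|_p^p=\sum_{i=1}^n|\langle A_i,x\rangle|^p$ and $A_i$ is the $i$-th row of $A$. *)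

theory Defs
  imports "HOL-Probability.Probability"
begin

text \<open>
  The dimension $d$ is \<open>CARD('d)\<close>. An $n \times d$ matrix is the list of its $n$ rows, since
  $n$ is not fixed throughout the statement.
\<close>

type_synonym 'd rows = "(real ^ 'd) list"

definition lp_form :: "real \<Rightarrow> 'd::finite rows \<Rightarrow> real ^ 'd \<Rightarrow> real" where
  "lp_form p A x = (\<Sum>i<length A. \<bar>A ! i \<bullet> x\<bar> powr p)"

text \<open>
  ``Entries specified by $O(\log(nd))$ bits'' is read as: integers whose absolute value has
  at most $C \log_2(nd)$ bits. The implied constant $C$ is a parameter.
\<close>

definition input_matrices :: "real \<Rightarrow> nat \<Rightarrow> 'd::finite rows set" where
  "input_matrices C n =
     {A. length A = n \<and>
         (\<forall>i<n. \<forall>j. A ! i $ j \<in> \<int> \<and>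
            \<bar>A ! i $ j\<bar> \<le> 2 powr (C * log 2 (real n * real CARD('d))))}"

text \<open>
  One outcome of the random coins of a data structure. The query procedure sees the matrix
  only through the stored bit string.
\<close>

record ('d::finite) sketch =
  store :: "'d rows \<Rightarrow> bool list"
  answer :: "bool list \<Rightarrow> real ^ 'd \<Rightarrow> real"

text \<open>
  A randomized data structure is a probability distribution \<open>D\<close> on deterministic ones, so
  that \<open>store\<close> and \<open>answer\<close> may share their coins free of charge. The measure \<open>D\<close> has an
  arbitrary sigma-algebra, and the set of outcomes that are correct for all queries need not
  be measurable; hence the event \<open>E\<close>.
\<close>

definition solves_subspace_sketch ::
  "real \<Rightarrow> real \<Rightarrow> nat \<Rightarrow> real \<Rightarrow> real \<Rightarrow> 'd::finite sketch measure \<Rightarrow> bool" where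
  "solves_subspace_sketch C q n p \<epsilon> D \<longleftrightarrow>
     prob_space D \<and>
     (\<forall>A \<in> input_matrices C n. \<exists>E \<in> sets D. measure D E \<ge> q \<and>
        (\<forall>Q \<in> E. \<forall>x. \<bar>answer Q (store Q A) x - lp_form p A x\<bar> \<le> \<epsilon> * lp_form p A x))"

text \<open>
  Worst case over the coins. Almost-sure bounds are used because \<open>space D\<close> may contain null
  sets of outcomes that say nothing about the data structure.
\<close>

definition bits_used :: "'d::finite sketch measure \<Rightarrow> 'd rows \<Rightarrow> enat" where
  "bits_used D A = Inf {s. AE Q in D. enat (length (store Q A)) \<le> s}"

end

theory Submission
  imports Defs
begin

text \<open>
  Let $m = d - 1$. The hard inputs are the subsets of the $N = k^m$ integer rows $(1, i)$ with
  $i \in \{0, \dots, k-1\}^m$, where $k$ is of order $\varepsilon^{-2/(d+2p)}$. If two subsets differ in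
  at least $N/16$ rows, their forms must differ by at least a constant times $k^{(m-1)/2}$ at some
  $x$ with $|\langle (1,i), x\rangle| = O(k)$; this exceeds $\varepsilon$ times the size $O(N k^p)$ of the
  forms. Hence one memory state serves at most a Hamming ball of $2^{N/2}$ subsets, and averaging
  over the coins gives $\Omega(N)$ bits.

  For the separation, let $a$ be the difference of the indicators of the two subsets and write
  the difference of the forms at $x = (-s, y)$ as
  $G_y(s) = \sum_i a_i |\langle i, y\rangle - s|^p$. A finite difference
  of high order in $s$ replaces $|\cdot|^p$ by an integrable, rapidly decaying function $h$, which is
  nonzero because $p$ is not an even integer; so its Fourier transform is bounded below on some
  interval of positive frequencies. By Bessel's inequality on a window of length $O(k)$, the
  exponential sums $\sum_i a_i e^{-i \tau \langle i, y\rangle}$ at $\Theta(k)$ frequencies $\tau$ of that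
  interval are controlled by the supremum of $G_y$. Averaging over $y$ and using Parseval, they are
  large for some $y$. Using all these frequencies at a single $y$ gains the factor $\sqrt{k}$ that a
  single Fourier coefficient would miss.
\<close>

subsection \<open>Finite differences\<close>

text \<open>The forward difference of order \<open>r\<close> with unit step. It commutes with
  translations, so on a sum of translates of one function it merely replaces that function.\<close>

primrec fdiff :: "nat \<Rightarrow> (real \<Rightarrow> real) \<Rightarrow> real \<Rightarrow> real" where
  "fdiff 0 f t = f t"
| "fdiff (Suc r) f t = fdiff r f (t + 1) - fdiff r f t"

text \<open>Differencing \<open>f\<close> first is the order that the induction for the mean value
  theorem needs.\<close>

lemma fdiff_Suc_inner: "fdiff (Suc r) f t = fdiff r (\<lambda>u. f (u + 1) - f u) t"
proof (induction r arbitrary: t)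
  case (Suc r)
  show ?case unfolding fdiff.simps(2)[of "Suc r" f] Suc by simp
qed simp

lemma fdiff_add: "fdiff r (\<lambda>u. f u + g u) t = fdiff r f t + fdiff r g t"
  by (induction r arbitrary: t) auto

lemma fdiff_cmult: "fdiff r (\<lambda>u. c * f u) t = c * fdiff r f t"
  by (induction r arbitrary: t) (auto simp: algebra_simps)

lemma fdiff_shift: "fdiff r (\<lambda>u. f (u - v)) t = fdiff r f (t - v)"
  by (induction r arbitrary: t) (auto simp: algebra_simps)

lemma fdiff_sum: "fdiff r (\<lambda>u. \<Sum>i\<in>I. f i u) t = (\<Sum>i\<in>I. fdiff r (f i) t)"
  by (induction r arbitrary: t) (auto simp: sum_subtractf)

lemma continuous_on_fdiff:
  assumes "continuous_on UNIV f"
  shows "continuous_on UNIV (fdiff r f)"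
proof (induction r)
  case 0
  then show ?case using assms by simp
next
  case (Suc r)
  have "continuous_on UNIV (\<lambda>t. fdiff r f (t + 1))"
    by (rule continuous_on_compose2[OF Suc]) (auto intro!: continuous_intros)
  then show ?case using Suc by (auto intro!: continuous_intros)
qed

lemma fdiff_bound:
  assumes "\<And>u. t \<le> u \<Longrightarrow> u \<le> t + real r \<Longrightarrow> \<bar>f u\<bar> \<le> M"
  shows "\<bar>fdiff r f t\<bar> \<le> 2 ^ r * M"
  using assms
proof (induction r arbitrary: t)
  case (Suc r)
  have "\<bar>fdiff r f (t + 1)\<bar> \<le> 2 ^ r * M" "\<bar>fdiff r f t\<bar> \<le> 2 ^ r * M"
    by (rule Suc.IH; use Suc.prems in simp)+
  then show ?case by simp
qed auto

text \<open>The sample points \<open>t, ..., t + r\<close> reflect to a window starting at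
  \<open>- t - r\<close>, and each difference changes sign. This carries decay at plus infinity over
  to minus infinity.\<close>

lemma fdiff_reflect:
  assumes "\<And>u. f (- u) = f u"
  shows "fdiff r f t = (-1) ^ r * fdiff r f (- t - real r)"
proof (induction r arbitrary: t)
  case 0
  then show ?case using assms[of t] by simp
next
  case (Suc r)
  show ?case
    using Suc[of t] Suc[of "t + 1"] arg_cong[of "- 1 - (t + real r)" "- t - (1 + real r)" "fdiff r f"]
    by (simp add: algebra_simps)
qed

text \<open>The differences \<open>F j (u + 1) - F j u\<close> again form a chain of derivatives.
  The induction hypothesis turns \<open>r\<close> of the differences into derivatives, and the
  ordinary mean value theorem turns the last one.\<close>

lemma fdiff_mean_value:
  assumes "\<And>j u. t \<le> u \<Longrightarrow> u \<le> t + real r \<Longrightarrow> (F j has_real_derivative F (Suc j) u) (at u)"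
  obtains \<xi> where "t \<le> \<xi>" "\<xi> \<le> t + real r" "fdiff r (F 0) t = F r \<xi>"
  using assms
proof (induction r arbitrary: F t thesis)
  case 0
  then show ?case by simp
next
  case (Suc r)
  define F' where "F' = (\<lambda>j u. F j (u + 1) - F j u)"
  have "(F' j has_real_derivative F' (Suc j) u) (at u)" if "t \<le> u" "u \<le> t + real r" for j u
  proof -
    have "(F j has_real_derivative F (Suc j) (u + 1)) (at (u + 1))"
      using that by (intro Suc.prems) auto
    then have "((\<lambda>u. F j (u + 1)) has_real_derivative F (Suc j) (u + 1)) (at u)"
      by (simp add: DERIV_shift)
    moreover have "(F j has_real_derivative F (Suc j) u) (at u)"
      using that by (intro Suc.prems) auto
    ultimately show ?thesis unfolding F'_def by (rule DERIV_diff)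
  qed
  then obtain \<xi> where xi: "t \<le> \<xi>" "\<xi> \<le> t + real r"
    and eq: "fdiff r (F' 0) t = F' r \<xi>"
    using Suc.IH[of t F'] by blast
  have "\<exists>z>\<xi>. z < \<xi> + 1 \<and> F r (\<xi> + 1) - F r \<xi> = (\<xi> + 1 - \<xi>) * F (Suc r) z"
    using xi by (intro MVT2) (auto intro!: Suc.prems)
  then obtain z where "\<xi> < z" "z < \<xi> + 1" "F' r \<xi> = F (Suc r) z"
    by (auto simp: F'_def)
  moreover have "fdiff (Suc r) (F 0) t = fdiff r (F' 0) t"
    unfolding F'_def by (rule fdiff_Suc_inner)
  ultimately show ?case using xi eq by (intro Suc.prems(1)[of z]) auto
qed

section \<open>Decay and non-vanishing of the differences of
  \<open>\<bar>u\<bar> powr p\<close>\<close>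

lemma fdiff_abs_powr_mean_value:
  fixes p :: real
  assumes "t > 0"
  obtains \<xi> where "t \<le> \<xi>"
    "fdiff r (\<lambda>u. \<bar>u\<bar> powr p) t = (\<Prod>l<r. p - real l) * \<xi> powr (p - real r)"
proof -
  \<comment> \<open>The successive derivatives of \<open>u powr p\<close>, written with
    \<open>\<bar>u\<bar>\<close> so that \<open>F 0\<close> is the given function; near a positive
    point the absolute value disappears.\<close>
  define F where "F = (\<lambda>j u. (\<Prod>l<j. p - real l) * \<bar>u\<bar> powr (p - real j))"
  have "(F j has_real_derivative F (Suc j) u) (at u)" if "t \<le> u" for j u
  proof -
    have "((\<lambda>u. (\<Prod>l<j. p - real l) * u powr (p - real j)) has_real_derivative F (Suc j) u) (at u)"
      unfolding F_def using that assms
      by (auto intro!: derivative_eq_intros simp: algebra_simps)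
    then show ?thesis
      by (rule has_field_derivative_transform_within_open[where S = "{0<..}"])
         (use that assms in \<open>auto simp: F_def\<close>)
  qed
  then obtain \<xi> where "t \<le> \<xi>" "fdiff r (F 0) t = F r \<xi>"
    by (rule fdiff_mean_value)
  moreover have "F 0 = (\<lambda>u. \<bar>u\<bar> powr p)" by (simp add: F_def)
  ultimately show ?thesis using assms by (intro that[of \<xi>]) (auto simp: F_def)
qed

lemma continuous_on_abs_powr:
  fixes p :: real
  assumes "p > 0"
  shows "continuous_on UNIV (\<lambda>u::real. \<bar>u\<bar> powr p)"
  using assms by (intro continuous_on_powr' continuous_intros) auto

text \<open>At a point \<open>t \<ge> 1\<close> the mean value form bounds the difference by a
  multiple of \<open>t powr (p - r)\<close>, and \<open>r\<close> is large enough to absorb the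
  weight. Reflection handles the far left and compactness the middle.\<close>

lemma fdiff_abs_powr_decay:
  fixes p :: real
  assumes p: "p > 0" and r: "real r \<ge> p + real m + 2"
  obtains B where "\<And>t. (1 + t\<^sup>2) * \<bar>t\<bar> ^ m * \<bar>fdiff r (\<lambda>u. \<bar>u\<bar> powr p) t\<bar> \<le> B"
proof -
  define h where "h = fdiff r (\<lambda>u. \<bar>u\<bar> powr p)"
  define K where "K = \<bar>\<Prod>l<r. p - real l\<bar>"
  have K: "K \<ge> 0" by (simp add: K_def)
  have pos: "u ^ (m + 2) * \<bar>h u\<bar> \<le> K" if u: "u \<ge> 1" for u
  proof -
    obtain \<xi> where xi: "u \<le> \<xi>" and eq: "h u = (\<Prod>l<r. p - real l) * \<xi> powr (p - real r)"
      unfolding h_def by (rule fdiff_abs_powr_mean_value[of u r p]) (use u in auto)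
    have "\<bar>h u\<bar> = K * \<xi> powr (p - real r)" by (simp add: eq abs_mult K_def)
    also have "\<dots> \<le> K * u powr (p - real r)"
      using xi u r K by (intro mult_left_mono powr_mono2') auto
    finally have "u ^ (m + 2) * \<bar>h u\<bar> \<le> u ^ (m + 2) * (K * u powr (p - real r))"
      using u by (intro mult_left_mono) auto
    also have "\<dots> = K * u powr (real (m + 2) + (p - real r))"
      using u by (simp only: powr_add powr_realpow[symmetric] mult_ac)
    also have "\<dots> \<le> K * u powr 0"
      using u r K by (intro mult_left_mono powr_mono) auto
    finally show ?thesis using u by simp
  qed
  have weight: "(1 + t\<^sup>2) * \<bar>t\<bar> ^ m \<le> 2 * \<bar>t\<bar> ^ (m + 2)" if "\<bar>t\<bar> \<ge> 1" for t :: real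
  proof -
    have "1 \<le> t\<^sup>2" using that by (metis one_le_power power2_abs)
    then have "(1 + t\<^sup>2) * \<bar>t\<bar> ^ m \<le> (2 * t\<^sup>2) * \<bar>t\<bar> ^ m"
      by (intro mult_right_mono) auto
    then show ?thesis by (simp add: power_add power2_eq_square mult_ac)
  qed
  \<comment> \<open>The interval covers what the two tails leave out: once
    \<open>t \<le> - r - 1\<close>, the reflected point \<open>- t - r\<close> is at least
    1.\<close>
  have "continuous_on {- real r - 1..1} h"
    unfolding h_def
    by (rule continuous_on_subset[OF continuous_on_fdiff[OF continuous_on_abs_powr[OF p]]]) simp
  then have "continuous_on {- real r - 1..1} (\<lambda>t. (1 + t\<^sup>2) * \<bar>t\<bar> ^ m * \<bar>h t\<bar>)"
    by (intro continuous_intros)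
  then have "bounded ((\<lambda>t. (1 + t\<^sup>2) * \<bar>t\<bar> ^ m * \<bar>h t\<bar>) ` {- real r - 1..1})"
    by (intro compact_imp_bounded compact_continuous_image compact_Icc)
  then obtain B0 where "\<forall>y\<in>(\<lambda>t. (1 + t\<^sup>2) * \<bar>t\<bar> ^ m * \<bar>h t\<bar>) ` {- real r - 1..1}. norm y \<le> B0"
    unfolding bounded_iff by blast
  then have B0: "(1 + t\<^sup>2) * \<bar>t\<bar> ^ m * \<bar>h t\<bar> \<le> B0" if "t \<in> {- real r - 1..1}" for t
    using that by (simp only: Ball_image_comp ball_simps real_norm_def comp_def) (blast dest: abs_le_D1)
  show ?thesis
  proof (rule that, fold h_def)
    fix t
    let ?B = "max B0 (2 * (real r + 1) ^ (m + 2) * K)"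
    consider "t \<in> {- real r - 1..1}" | "t \<ge> 1" | "t \<le> - real r - 1"
      by force
    then show "(1 + t\<^sup>2) * \<bar>t\<bar> ^ m * \<bar>h t\<bar> \<le> ?B"
    proof cases
      case 1
      then show ?thesis using B0 by (simp add: le_max_iff_disj)
    next
      case 2
      have "(1 + t\<^sup>2) * \<bar>t\<bar> ^ m * \<bar>h t\<bar> \<le> 2 * t ^ (m + 2) * \<bar>h t\<bar>"
        using weight[of t] 2 by (intro mult_right_mono) auto
      also have "\<dots> \<le> 2 * K" using pos[OF 2] by simp
      also have "2 * K \<le> 2 * (real r + 1) ^ (m + 2) * K"
        using K one_le_power[of "real r + 1" "m + 2"] by (intro mult_right_mono) auto
      finally show ?thesis by simp
    next
      case 3
      define u where "u = - t - real r"
      have u: "u \<ge> 1" using 3 by (simp add: u_def)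
      have "h t = (-1) ^ r * h u"
        unfolding h_def u_def by (rule fdiff_reflect) simp
      then have hu: "\<bar>h t\<bar> = \<bar>h u\<bar>" by (simp add: abs_mult power_abs)
      have "\<bar>t\<bar> = u + real r" using 3 by (simp add: u_def)
      also have "\<dots> \<le> (real r + 1) * u"
        using u mult_right_mono[of 1 u "real r"] by (simp add: algebra_simps)
      finally have tu: "\<bar>t\<bar> ^ (m + 2) \<le> ((real r + 1) * u) ^ (m + 2)"
        by (intro power_mono) auto
      have "(1 + t\<^sup>2) * \<bar>t\<bar> ^ m * \<bar>h t\<bar> \<le> 2 * \<bar>t\<bar> ^ (m + 2) * \<bar>h t\<bar>"
        using weight[of t] 3 by (intro mult_right_mono) auto
      also have "\<dots> \<le> 2 * ((real r + 1) * u) ^ (m + 2) * \<bar>h u\<bar>"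
        unfolding hu using tu by (intro mult_right_mono mult_left_mono) auto
      also have "\<dots> = 2 * (real r + 1) ^ (m + 2) * (u ^ (m + 2) * \<bar>h u\<bar>)"
        by (simp only: power_mult_distrib mult_ac)
      also have "\<dots> \<le> 2 * (real r + 1) ^ (m + 2) * K"
        using pos[OF u] by (intro mult_left_mono) auto
      finally show ?thesis by simp
    qed
  qed
qed

text \<open>The sample points \<open>t + 1, ..., t + r\<close> are nonnegative, so only the term at
  \<open>t\<close> itself survives.\<close>

lemma fdiff_eq_if_zero_nonneg:
  assumes "\<And>u. u \<ge> 0 \<Longrightarrow> g u = 0" and "- 1 \<le> t"
  shows "fdiff r g t = (-1) ^ r * g t"
  using assms(2)
proof (induction r arbitrary: t)
  case (Suc r)
  then have "fdiff r g (t + 1) = (-1) ^ r * g (t + 1)" "fdiff r g t = (-1) ^ r * g t"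
    by auto
  then show ?case using assms(1)[of "t + 1"] Suc.prems by simp
qed auto

lemma fdiff_power_eq_0:
  assumes "r > q"
  shows "fdiff r (\<lambda>u. u ^ q) t = 0"
proof -
  \<comment> \<open>For \<open>j > q\<close> the exponent \<open>q - j\<close> truncates to 0, which
    is harmless: the product then contains the zero factor \<open>l = q\<close>.\<close>
  define F :: "nat \<Rightarrow> real \<Rightarrow> real"
    where "F = (\<lambda>j u. (\<Prod>l<j. real q - real l) * u ^ (q - j))"
  have "(F j has_real_derivative F (Suc j) u) (at u)" for j u
  proof (cases "j \<le> q")
    case True
    then show ?thesis unfolding F_def
      by (auto intro!: derivative_eq_intros simp: of_nat_diff)
  next
    case False
    then have "(\<Prod>l<j. real q - real l) = 0" "(\<Prod>l<Suc j. real q - real l) = 0"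
      by (auto simp: prod_zero_iff)
    then have "F j = (\<lambda>_. 0)" "F (Suc j) u = 0" by (auto simp only: F_def)
    then show ?thesis by simp
  qed
  then obtain \<xi> where "fdiff r (F 0) t = F r \<xi>"
    using fdiff_mean_value[of t r F] by blast
  moreover have "(\<Prod>l<r. real q - real l) = 0" using assms by (auto simp: prod_zero_iff)
  ultimately show ?thesis by (simp add: F_def)
qed

text \<open>For odd \<open>p\<close> the differences vanish far from the origin, so the non-integral case and the odd
  case need different test points.\<close>

lemma fdiff_abs_powr_nonzero:
  fixes p :: real
  assumes p: "p > 0" and noneven: "\<not> (\<exists>k::int. p = 2 * of_int k)" and r: "real r > p"
  obtains t where "fdiff r (\<lambda>u. \<bar>u\<bar> powr p) t \<noteq> 0"
proof (cases "\<exists>q::nat. p = real q")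
  \<comment> \<open>For non-integral \<open>p\<close> no factor of the falling factorial vanishes,
    so the mean value form is nonzero at any positive point.\<close>
  case False
  obtain \<xi> where "1 \<le> \<xi>"
    "fdiff r (\<lambda>u. \<bar>u\<bar> powr p) 1 = (\<Prod>l<r. p - real l) * \<xi> powr (p - real r)"
    by (rule fdiff_abs_powr_mean_value[of 1 r p]) auto
  moreover have "(\<Prod>l<r. p - real l) \<noteq> 0" using False by (auto simp: prod_zero_iff)
  ultimately show ?thesis by (intro that[of 1]) auto
next
  case True
  then obtain q where q: "p = real q" by blast
  have "odd q"
  proof
    assume "even q"
    then obtain k where "q = 2 * k" by (rule evenE)
    then have "p = 2 * of_int (int k)" using q by simp
    then show False using noneven by blast
  qed
  \<comment> \<open>For odd \<open>q\<close>, \<open>\<bar>u\<bar> ^ q\<close> is the polynomial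
    \<open>u ^ q\<close> plus \<open>g\<close>. The difference kills the polynomial, and at
    \<open>- 1 / 2\<close> it sees \<open>g\<close> at one negative point only.\<close>
  define g where "g = (\<lambda>u::real. if u < 0 then 2 * \<bar>u\<bar> ^ q else 0)"
  have q0: "q > 0" using p q by simp
  have "\<bar>u\<bar> powr p = u ^ q + g u" for u
    using \<open>odd q\<close> q0 unfolding g_def q by (cases "u = 0") (auto simp: powr_realpow)
  then have "fdiff r (\<lambda>u. \<bar>u\<bar> powr p) (- (1 / 2)) = fdiff r g (- (1 / 2))"
    using r q by (simp add: fdiff_add fdiff_power_eq_0)
  also have "\<dots> = (-1) ^ r * g (- (1 / 2))"
    by (rule fdiff_eq_if_zero_nonneg) (auto simp: g_def)
  also have "\<dots> \<noteq> 0" by (simp add: g_def)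
  finally show ?thesis by (rule that)
qed

subsection \<open>Fourier transforms of real functions\<close>

definition fourier :: "(real \<Rightarrow> real) \<Rightarrow> real \<Rightarrow> complex" where
  "fourier h \<tau> = (CLINT t|lborel. of_real (h t) * iexp (- (\<tau> * t)))"

lemma fourier_integrable:
  assumes "integrable lborel h"
  shows "complex_integrable lborel (\<lambda>t. of_real (h t) * iexp (- (\<tau> * t)))"
  by (rule Bochner_Integration.integrable_bound[OF assms])
     (use assms in \<open>auto simp: norm_mult intro!: borel_measurable_times borel_measurable_of_real
        borel_measurable_continuous_onI continuous_intros\<close>)

lemma isCont_fourier:
  assumes h: "integrable lborel h"
  shows "isCont (fourier h) \<tau>"
  unfolding continuous_at_sequentially
proof safe
  fix X assume X: "X \<longlonglongrightarrow> \<tau>"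
  have [measurable]: "h \<in> borel_measurable borel" using h by auto
  show "(fourier h \<circ> X) \<longlonglongrightarrow> fourier h \<tau>"
    unfolding comp_def fourier_def
    by (rule integral_dominated_convergence[where w="\<lambda>t. \<bar>h t\<bar>"])
       (use h in \<open>auto intro!: tendsto_intros X simp: norm_mult\<close>)
qed

text \<open>As \<open>h\<close> is real, reflecting the frequency conjugates the transform; hence
  nonnegative frequencies suffice.\<close>

lemma norm_fourier_minus: "norm (fourier h (- \<tau>)) = norm (fourier h \<tau>)"
proof -
  have "fourier h (- \<tau>) = (CLINT t|lborel. cnj (of_real (h t) * iexp (- (\<tau> * t))))"
    unfolding fourier_def by (intro Bochner_Integration.integral_cong) (auto simp: exp_cnj)
  also have "\<dots> = cnj (fourier h \<tau>)"
    unfolding fourier_def by (rule Bochner_Integration.integral_cnj)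
  finally show ?thesis by simp
qed

text \<open>The set where \<open>h\<close> is nonzero is open and null, hence empty.\<close>

lemma continuous_AE_lborel_eq_0:
  fixes h :: "real \<Rightarrow> real"
  assumes "continuous_on UNIV h" "AE t in lborel. h t = 0"
  shows "h t = 0"
proof (rule ccontr)
  assume "h t \<noteq> 0"
  let ?U = "{t. h t \<noteq> 0}"
  have op: "open ?U" using assms(1) by (intro open_Collect_neq continuous_intros)
  then have "?U \<in> null_sets lborel"
    using assms(2) by (subst (asm) AE_iff_null) auto
  then have "negligible ?U"
    by (simp add: negligible_iff_null_sets null_sets_completionI)
  then show False using open_not_negligible[OF op] \<open>h t \<noteq> 0\<close> by blast
qed

text \<open>If the transform vanished, the positive and negative parts of \<open>h\<close> would
  have equal transforms. Scaled by their common mass they are probability densities with the same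
  characteristic function, so Levy's uniqueness theorem makes them equal.\<close>

lemma fourier_nonzero:
  assumes cont: "continuous_on UNIV h" and int: "integrable lborel h" and nz: "h t \<noteq> 0"
  obtains \<tau> where "fourier h \<tau> \<noteq> 0"
proof (rule ccontr)
  assume "\<not> thesis"
  then have zero: "fourier h \<tau> = 0" for \<tau> using that by blast
  define f where "f = (\<lambda>t. max 0 (h t))"
  define g where "g = (\<lambda>t. max 0 (- h t))"
  have fint: "integrable lborel f" and gint: "integrable lborel g"
    unfolding f_def g_def using int by (auto intro!: integrable_max)
  have fm[measurable]: "f \<in> borel_measurable borel" "g \<in> borel_measurable borel"
    using fint gint by auto
  have fg: "h t = f t - g t" "f t \<ge> 0" "g t \<ge> 0" for t by (auto simp: f_def g_def)
  have eq: "fourier f \<tau> = fourier g \<tau>" for \<tau>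
  proof -
    have "fourier h \<tau> = (CLINT t|lborel. of_real (f t) * iexp (- (\<tau> * t)) - of_real (g t) * iexp (- (\<tau> * t)))"
      unfolding fourier_def by (intro Bochner_Integration.integral_cong) (simp_all add: fg(1) left_diff_distrib)
    also have "\<dots> = fourier f \<tau> - fourier g \<tau>"
      unfolding fourier_def
      by (intro Bochner_Integration.integral_diff fourier_integrable fint gint)
    finally have "fourier h \<tau> = fourier f \<tau> - fourier g \<tau>" .
    then show ?thesis using zero by simp
  qed
  define c where "c = (\<integral>t. f t \<partial>lborel)"
  have c0: "c \<ge> 0" unfolding c_def using fg by (intro integral_nonneg_AE) auto
  have "complex_of_real c = complex_of_real (\<integral>t. g t \<partial>lborel)"
    using eq[of 0] by (simp add: fourier_def c_def)
  then have cg: "c = (\<integral>t. g t \<partial>lborel)" by (simp only: of_real_eq_iff)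
  have "AE t in lborel. f t = g t"
  \<comment> \<open>Without mass there is nothing to normalise, but then both parts vanish almost
    everywhere.\<close>
  proof (cases "c = 0")
    case True
    then have "AE t in lborel. f t = 0" "AE t in lborel. g t = 0"
      using integral_nonneg_eq_0_iff_AE[OF fint] integral_nonneg_eq_0_iff_AE[OF gint] fg cg c_def
      by auto
    then show ?thesis by eventually_elim simp
  next
    case False
    then have c: "c > 0" using c0 by simp
    define D where "D = (\<lambda>u::real \<Rightarrow> real. density lborel (\<lambda>t. ennreal (u t / c)))"
    have dist: "real_distribution (D u)"
      if "u \<in> borel_measurable borel" "integrable lborel u" "\<And>t. u t \<ge> 0" "(\<integral>t. u t \<partial>lborel) = c" for u
    proof -
      have "(\<integral>\<^sup>+t. ennreal (u t / c) \<partial>lborel) = ennreal (\<integral>t. u t / c \<partial>lborel)"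
        using that c by (intro nn_integral_eq_integral) auto
      also have "\<dots> = 1" using that c by simp
      finally have "prob_space (D u)"
        unfolding D_def using that by (intro prob_spaceI) (simp add: emeasure_density)
      then show ?thesis
        unfolding real_distribution_def real_distribution_axioms_def D_def by simp
    qed
    have char: "char (D u) \<tau> = fourier u (- \<tau>) / c"
      if "u \<in> borel_measurable borel" "integrable lborel u" "\<And>t. u t \<ge> 0" for u \<tau>
    proof -
      have "char (D u) \<tau> = (CLINT t|lborel. (u t / c) *\<^sub>R iexp (\<tau> * t))"
        unfolding char_def D_def using that c
        by (intro integral_density) auto
      also have "\<dots> = (CLINT t|lborel. (of_real (u t) * iexp (- (- \<tau> * t))) / of_real c)"
        by (intro Bochner_Integration.integral_cong) (auto simp: scaleR_conv_of_real)
      also have "\<dots> = fourier u (- \<tau>) / c"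
        unfolding fourier_def by (rule integral_divide_zero)
      finally show ?thesis .
    qed
    have "D f = D g"
      using fint gint fg cg c_def
      by (intro Levy_uniqueness dist ext) (auto simp: char eq)
    then have "AE t in lborel. ennreal (f t / c) = ennreal (g t / c)"
      unfolding D_def by (intro sigma_finite_measure.density_unique sigma_finite_lborel) auto
    then show ?thesis
      by eventually_elim (use c fg in \<open>simp add: ennreal_inj\<close>)
  qed
  then have "AE t in lborel. h t = 0" by eventually_elim (simp add: fg(1))
  then show False using continuous_AE_lborel_eq_0[OF cont] nz by blast
qed

lemma fourier_bounded_below_on_interval:
  assumes cont: "continuous_on UNIV h" and int: "integrable lborel h" and nz: "h t \<noteq> 0"
  obtains \<alpha> \<rho> c where "\<alpha> > 0" "\<rho> > 0" "c > 0"
    "\<And>\<tau>. \<alpha> \<le> \<tau> \<Longrightarrow> \<tau> \<le> \<alpha> + \<rho> \<Longrightarrow> c \<le> norm (fourier h \<tau>)"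
proof -
  obtain \<tau>' where "fourier h \<tau>' \<noteq> 0" using fourier_nonzero[OF cont int nz] by blast
  then have nz: "fourier h \<bar>\<tau>'\<bar> \<noteq> 0"
    using norm_fourier_minus[of h \<tau>'] by (auto simp: abs_if)
  define c where "c = norm (fourier h \<bar>\<tau>'\<bar>) / 2"
  have c: "c > 0" using nz by (simp add: c_def)
  obtain e where e: "e > 0"
    "\<And>\<tau>. dist \<tau> \<bar>\<tau>'\<bar> < e \<Longrightarrow> dist (fourier h \<tau>) (fourier h \<bar>\<tau>'\<bar>) < c"
    using isCont_fourier[OF int, of "\<bar>\<tau>'\<bar>"] c unfolding continuous_at_eps_delta dist_norm
    by (auto simp: real_norm_def)
  show ?thesis
  \<comment> \<open>Starting the interval \<open>e / 4\<close> to the right keeps its left end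
    positive even when the frequency found is 0.\<close>
  proof (rule that[of "\<bar>\<tau>'\<bar> + e / 4" "e / 4" c])
    fix \<tau> assume "\<bar>\<tau>'\<bar> + e / 4 \<le> \<tau>" "\<tau> \<le> \<bar>\<tau>'\<bar> + e / 4 + e / 4"
    then have "dist (fourier h \<tau>) (fourier h \<bar>\<tau>'\<bar>) < c"
      using e by (auto simp: dist_real_def)
    then show "c \<le> norm (fourier h \<tau>)"
      using norm_triangle_ineq2[of "fourier h \<bar>\<tau>'\<bar>" "fourier h \<tau>"]
      by (simp add: c_def dist_norm norm_minus_commute)
  qed (use e c in auto)
qed

subsection \<open>Bessel's inequality for sums of translates\<close>

text \<open>For \<open>l \<noteq> n\<close> the integrand is an exponential whose primitive takes
  the same value at both ends of a period.\<close>

lemma integral_iexp_period: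
  fixes l n :: nat
  assumes T: "T > 0"
  shows "((\<lambda>s. iexp (- (2 * pi * n / T * s)) * cnj (iexp (- (2 * pi * l / T * s)))) has_integral
    (if l = n then of_real T else 0)) {A..A + T}"
proof (cases "l = n")
  case True
  have "((\<lambda>s. 1 :: complex) has_integral of_real T) {A..A + T}"
    using has_integral_const_real[of "1 :: complex" A "A + T"] T by (simp add: scaleR_conv_of_real)
  moreover have "iexp (- (2 * pi * n / T * s)) * cnj (iexp (- (2 * pi * n / T * s))) = 1" for s
    by (simp flip: exp_add add: exp_cnj)
  ultimately show ?thesis using True by simp
next
  case False
  define \<kappa> where "\<kappa> = 2 * pi * (real l - real n) / T"
  have \<kappa>: "\<kappa> \<noteq> 0" using False T by (simp add: \<kappa>_def)
  have eq: "iexp (- (2 * pi * n / T * s)) * cnj (iexp (- (2 * pi * l / T * s))) = iexp (\<kappa> * s)" for s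
    using T by (simp flip: exp_add add: exp_cnj \<kappa>_def field_simps)
  have "((\<lambda>s. iexp (\<kappa> * s)) has_integral
      iexp (\<kappa> * (A + T)) / (\<i> * \<kappa>) - iexp (\<kappa> * A) / (\<i> * \<kappa>)) {A..A + T}"
    using T \<kappa>
    by (intro fundamental_theorem_of_calculus)
       (auto intro!: derivative_eq_intros simp: has_vector_derivative_complex_iff Re_exp Im_exp
         Re_divide Im_divide power2_eq_square field_simps)
  moreover have "iexp (\<kappa> * (A + T)) = iexp (\<kappa> * A)"
  proof -
    have "\<kappa> * (A + T) = \<kappa> * A + 2 * pi * of_int (int l - int n)"
      using T by (simp add: \<kappa>_def field_simps)
    then have "iexp (\<kappa> * (A + T)) = iexp (\<kappa> * A) * iexp (2 * pi * of_int (int l - int n))"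
      by (simp only: of_real_add distrib_left exp_add)
    also have "iexp (2 * pi * of_int (int l - int n)) = 1"
      using exp_integer_2pi[of "of_int (int l - int n)"] by (simp add: mult_ac)
    finally show ?thesis by simp
  qed
  ultimately show ?thesis using False eq by simp
qed

text \<open>With \<open>S\<close> the sum on the left, integrating the square of
  \<open>norm (T * H - cnj \<phi>)\<close> gives \<open>T\<^sup>2\<close> times the integral of
  \<open>H\<^sup>2\<close>, minus \<open>T * S\<close>, and this is nonnegative.\<close>

lemma bessel_inequality_interval:
  fixes H :: "real \<Rightarrow> real" and F :: "nat set"
  assumes T: "T > 0" and cont: "continuous_on UNIV H" and F: "finite F"
    and M: "\<And>s. s \<in> {A..A + T} \<Longrightarrow> \<bar>H s\<bar> \<le> M"
  shows "(\<Sum>n\<in>F. (norm (integral {A..A + T} (\<lambda>s. of_real (H s) * iexp (- (2 * pi * real n / T * s)))))\<^sup>2)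
    \<le> T\<^sup>2 * M\<^sup>2"
proof -
  let ?W = "{A..A + T}"
  define e where "e = (\<lambda>(n::nat) s. iexp (- (2 * pi * n / T * s)))"
  define c where "c = (\<lambda>n. integral ?W (\<lambda>s. of_real (H s) * e n s))"
  define S where "S = (\<Sum>n\<in>F. (norm (c n))\<^sup>2)"
  \<comment> \<open>\<open>cnj \<phi>\<close> is \<open>T\<close> times the orthogonal projection of
    \<open>H\<close> onto the span of the conjugates of \<open>e n\<close>, each of which has
    squared norm \<open>T\<close>.\<close>
  define \<phi> where "\<phi> = (\<lambda>s. \<Sum>n\<in>F. cnj (c n) * e n s)"
  have Hc: "continuous_on ?W H" by (rule continuous_on_subset[OF cont]) simp
  have ec: "continuous_on ?W (e n)" for n unfolding e_def by (intro continuous_intros)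
  have ci: "((\<lambda>s. of_real (H s) * e n s) has_integral c n) ?W" for n
    unfolding c_def by (intro integrable_integral integrable_continuous_interval continuous_intros Hc ec)
  have S_eq: "(\<Sum>n\<in>F. cnj (c n) * c n) = of_real S"
    unfolding S_def of_real_sum by (intro sum.cong) (simp_all only: complex_norm_square mult.commute)
  have I1: "((\<lambda>s. of_real (H s) * \<phi> s) has_integral of_real S) ?W"
  proof -
    have "((\<lambda>s. \<Sum>n\<in>F. cnj (c n) * (of_real (H s) * e n s)) has_integral (\<Sum>n\<in>F. cnj (c n) * c n)) ?W"
      by (intro has_integral_sum F has_integral_mult_right ci)
    then show ?thesis unfolding S_eq by (simp add: \<phi>_def sum_distrib_left mult_ac)
  qed
  have I2: "((\<lambda>s. of_real (H s) * cnj (\<phi> s)) has_integral of_real S) ?W"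
    using has_integral_cnj[of "\<lambda>s. of_real (H s) * \<phi> s" "of_real S" ?W] I1 by (simp add: o_def)
  have I3: "((\<lambda>s. \<phi> s * cnj (\<phi> s)) has_integral of_real (T * S)) ?W"
  proof -
    have "((\<lambda>s. \<Sum>n\<in>F. \<Sum>l\<in>F. cnj (c n) * c l * (e n s * cnj (e l s))) has_integral
        (\<Sum>n\<in>F. \<Sum>l\<in>F. cnj (c n) * c l * (if l = n then of_real T else 0))) ?W"
      unfolding e_def
      by (intro has_integral_sum F has_integral_mult_right integral_iexp_period T)
    moreover have "(\<Sum>n\<in>F. \<Sum>l\<in>F. cnj (c n) * c l * (if l = n then of_real T else 0)) = of_real (T * S)"
      using F by (simp add: S_eq[symmetric] if_distrib sum_distrib_left mult_ac cong: if_cong)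
    moreover have "\<phi> s * cnj (\<phi> s) = (\<Sum>n\<in>F. \<Sum>l\<in>F. cnj (c n) * c l * (e n s * cnj (e l s)))" for s
      unfolding \<phi>_def cnj_sum sum_product by (intro sum.cong) (simp_all add: mult_ac)
    ultimately show ?thesis by simp
  qed
  have I0: "((\<lambda>s. complex_of_real ((H s)\<^sup>2)) has_integral of_real (integral ?W (\<lambda>s. (H s)\<^sup>2))) ?W"
    by (intro has_integral_of_real integrable_integral integrable_continuous_interval continuous_intros Hc)
  have "((\<lambda>s. (of_real T)\<^sup>2 * complex_of_real ((H s)\<^sup>2) - of_real T * (of_real (H s) * \<phi> s)
        - of_real T * (of_real (H s) * cnj (\<phi> s)) + \<phi> s * cnj (\<phi> s)) has_integral
      (of_real T)\<^sup>2 * of_real (integral ?W (\<lambda>s. (H s)\<^sup>2)) - of_real T * of_real S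
        - of_real T * of_real S + of_real (T * S)) ?W"
    by (intro has_integral_add has_integral_diff has_integral_mult_right I0 I1 I2 I3)
  moreover have "(of_real T)\<^sup>2 * complex_of_real ((H s)\<^sup>2) - of_real T * (of_real (H s) * \<phi> s)
        - of_real T * (of_real (H s) * cnj (\<phi> s)) + \<phi> s * cnj (\<phi> s)
      = complex_of_real ((norm (of_real (T * H s) - cnj (\<phi> s)))\<^sup>2)" for s
    unfolding complex_norm_square by (simp add: power2_eq_square algebra_simps)
  moreover have "(of_real T)\<^sup>2 * of_real (integral ?W (\<lambda>s. (H s)\<^sup>2)) - of_real T * of_real S
        - of_real T * of_real S + of_real (T * S) = complex_of_real (T\<^sup>2 * integral ?W (\<lambda>s. (H s)\<^sup>2) - T * S)"
    by simp
  ultimately have "((\<lambda>s. complex_of_real ((norm (of_real (T * H s) - cnj (\<phi> s)))\<^sup>2)) has_integral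
      of_real (T\<^sup>2 * integral ?W (\<lambda>s. (H s)\<^sup>2) - T * S)) ?W"
    by (simp only:)
  from has_integral_Re[OF this]
  have "((\<lambda>s. (norm (of_real (T * H s) - cnj (\<phi> s)))\<^sup>2) has_integral
      T\<^sup>2 * integral ?W (\<lambda>s. (H s)\<^sup>2) - T * S) ?W" by simp
  then have "0 \<le> T\<^sup>2 * integral ?W (\<lambda>s. (H s)\<^sup>2) - T * S"
    by (rule has_integral_nonneg) simp
  then have "T * S \<le> T * (T * integral ?W (\<lambda>s. (H s)\<^sup>2))"
    by (simp add: power2_eq_square mult_ac)
  then have "S \<le> T * integral ?W (\<lambda>s. (H s)\<^sup>2)" using T by simp
  also have "integral ?W (\<lambda>s. (H s)\<^sup>2) \<le> integral ?W (\<lambda>s. M\<^sup>2)"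
  proof (rule integral_le)
    fix s assume "s \<in> ?W"
    from M[OF this] show "(H s)\<^sup>2 \<le> M\<^sup>2" by (metis abs_ge_zero power2_abs power_mono)
  qed (intro integrable_continuous_interval continuous_intros Hc)+
  also have "integral ?W (\<lambda>s. M\<^sup>2) = T * M\<^sup>2" using T by simp
  finally show ?thesis using T by (simp add: S_def c_def e_def power2_eq_square mult_left_mono)
qed

text \<open>Over the whole line the translate by \<open>t i\<close> has transform
  \<open>fourier h \<tau>\<close> times a phase. The window contains all points within
  \<open>W\<close> of \<open>t i\<close>, so truncation costs at most the tail mass of
  \<open>h\<close> beyond \<open>W\<close>.\<close>

lemma windowed_fourier_translates:
  fixes h :: "real \<Rightarrow> real" and a t :: "'i \<Rightarrow> real"
  assumes I: "finite I" and cont: "continuous_on UNIV h" and h: "integrable lborel h"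
    and t: "\<And>i. i \<in> I \<Longrightarrow> 0 \<le> t i" "\<And>i. i \<in> I \<Longrightarrow> t i + 2 * W \<le> T"
    and \<delta>: "(\<integral>s. indicator {s. \<bar>s\<bar> \<ge> W} s * \<bar>h s\<bar> \<partial>lborel) \<le> \<delta>"
  shows "norm (integral {- W..T - W} (\<lambda>s. of_real (\<Sum>i\<in>I. a i * h (s - t i)) * iexp (- (\<tau> * s)))
      - fourier h \<tau> * (\<Sum>i\<in>I. of_real (a i) * iexp (- (\<tau> * t i)))) \<le> \<delta> * (\<Sum>i\<in>I. \<bar>a i\<bar>)"
proof -
  let ?W = "{- W..T - W}"
  define J where "J = (\<lambda>i. integral ?W (\<lambda>s. of_real (h (s - t i)) * iexp (- (\<tau> * s))))"
  have hc: "continuous_on X (\<lambda>s. h (s - v))" for X v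
    by (rule continuous_on_compose2[OF cont]) (auto intro!: continuous_intros)
  have hm[measurable]: "h \<in> borel_measurable borel" using h by auto
  have shift: "integrable lborel (\<lambda>s. h (s - v))" for v
    using lborel_integrable_real_affine[OF h, of 1 "- v"] by simp
  have "((\<lambda>s. \<Sum>i\<in>I. of_real (a i) * (of_real (h (s - t i)) * iexp (- (\<tau> * s)))) has_integral
      (\<Sum>i\<in>I. of_real (a i) * J i)) ?W"
    unfolding J_def
    by (intro has_integral_sum I has_integral_mult_right integrable_integral
        integrable_continuous_interval continuous_intros hc)
  then have eq: "integral ?W (\<lambda>s. of_real (\<Sum>i\<in>I. a i * h (s - t i)) * iexp (- (\<tau> * s)))
      = (\<Sum>i\<in>I. of_real (a i) * J i)"
    by (simp add: integral_unique of_real_sum sum_distrib_left sum_distrib_right mult_ac)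
  have err: "norm (J i - fourier h \<tau> * iexp (- (\<tau> * t i))) \<le> \<delta>" if i: "i \<in> I" for i
  proof -
    define G where "G = (\<lambda>s. of_real (h (s - t i)) * iexp (- (\<tau> * s)))"
    have G: "complex_integrable lborel G"
    proof (rule Bochner_Integration.integrable_bound[OF shift[of "t i"]])
      show "G \<in> borel_measurable lborel"
        unfolding G_def by (auto intro!: borel_measurable_continuous_onI continuous_intros hc)
    qed (auto simp: G_def norm_mult)
    have Gset: "set_integrable lborel X G" if "X \<in> sets borel" for X
      using that G unfolding set_integrable_def by (intro integrable_mult_indicator) auto
    have J: "J i = (CLBINT s:?W. G s)"
      unfolding J_def G_def[symmetric] using set_borel_integral_eq_integral(2)[OF Gset] by simp
    have "(CLINT s|lborel. G s) = (CLINT s|lborel. G (t i + 1 * s))"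
      by (subst lborel_integral_real_affine[where c = 1 and t = "t i"]) auto
    also have "\<dots> = (CLINT s|lborel. iexp (- (\<tau> * t i)) * (of_real (h s) * iexp (- (\<tau> * s))))"
      unfolding G_def
      by (intro Bochner_Integration.integral_cong) (simp_all add: algebra_simps flip: exp_add)
    also have "\<dots> = fourier h \<tau> * iexp (- (\<tau> * t i))"
      unfolding fourier_def by simp
    finally have full: "(CLINT s|lborel. G s) = fourier h \<tau> * iexp (- (\<tau> * t i))" .
    have "(CLINT s|lborel. G s) = (CLBINT s:?W \<union> (- ?W). G s)"
      by (simp add: set_lebesgue_integral_def)
    also have "\<dots> = (CLBINT s:?W. G s) + (CLBINT s:- ?W. G s)"
      by (intro set_integral_Un Gset) auto
    finally have "J i - fourier h \<tau> * iexp (- (\<tau> * t i)) = - (CLBINT s:- ?W. G s)"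
      using full J by simp
    then have "norm (J i - fourier h \<tau> * iexp (- (\<tau> * t i))) = norm (CLBINT s:- ?W. G s)" by simp
    also have "\<dots> \<le> (LBINT s. norm (indicator (- ?W) s *\<^sub>R G s))"
      unfolding set_lebesgue_integral_def by (rule integral_norm_bound)
    also have "\<dots> \<le> (LBINT s. indicator {s. \<bar>s\<bar> \<ge> W} (s - t i) * \<bar>h (s - t i)\<bar>)"
    proof (rule integral_mono)
      show "integrable lborel (\<lambda>s. norm (indicator (- ?W) s *\<^sub>R G s))"
        using Gset[of "- ?W"] unfolding set_integrable_def by (intro integrable_norm) auto
      show "integrable lborel (\<lambda>s. indicator {s. \<bar>s\<bar> \<ge> W} (s - t i) * \<bar>h (s - t i)\<bar>)"
        by (rule Bochner_Integration.integrable_bound[OF shift[of "t i"]])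
           (auto simp: indicator_def)
      show "norm (indicator (- ?W) s *\<^sub>R G s) \<le> indicator {s. \<bar>s\<bar> \<ge> W} (s - t i) * \<bar>h (s - t i)\<bar>" for s
        using t[OF i] by (auto simp: G_def norm_mult indicator_def)
    qed
    also have "\<dots> = (LBINT s. indicator {s. \<bar>s\<bar> \<ge> W} s * \<bar>h s\<bar>)"
      by (subst lborel_integral_real_affine[where c = 1 and t = "t i"]) auto
    finally show ?thesis using \<delta> by simp
  qed
  have "norm (integral ?W (\<lambda>s. of_real (\<Sum>i\<in>I. a i * h (s - t i)) * iexp (- (\<tau> * s)))
      - fourier h \<tau> * (\<Sum>i\<in>I. of_real (a i) * iexp (- (\<tau> * t i))))
    = norm (\<Sum>i\<in>I. of_real (a i) * (J i - fourier h \<tau> * iexp (- (\<tau> * t i))))"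
    unfolding eq by (simp add: sum_subtractf sum_distrib_left algebra_simps)
  also have "\<dots> \<le> (\<Sum>i\<in>I. \<bar>a i\<bar> * \<delta>)"
    by (rule sum_norm_le) (simp only: norm_mult norm_of_real, intro mult_left_mono err, simp_all)
  finally show ?thesis by (simp add: sum_distrib_left mult_ac)
qed

text \<open>Bessel's inequality bounds the windowed coefficients of the sum of translates by its
  supremum; each differs from \<open>fourier h\<close> times the exponential sum by the truncation
  error only. The factors 2 come from squaring a sum of two terms.\<close>

lemma exponential_sums_le_sup:
  fixes h :: "real \<Rightarrow> real" and a t :: "'i \<Rightarrow> real" and F :: "nat set"
  assumes I: "finite I" and F: "finite F" and cont: "continuous_on UNIV h" and h: "integrable lborel h"
    and T: "T > 0"
    and t: "\<And>i. i \<in> I \<Longrightarrow> 0 \<le> t i" "\<And>i. i \<in> I \<Longrightarrow> t i + 2 * W \<le> T"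
    and \<delta>: "(\<integral>s. indicator {s. \<bar>s\<bar> \<ge> W} s * \<bar>h s\<bar> \<partial>lborel) \<le> \<delta>"
    and M: "\<And>s. s \<in> {- W..T - W} \<Longrightarrow> \<bar>\<Sum>i\<in>I. a i * h (s - t i)\<bar> \<le> M"
    and c: "c \<ge> 0" "\<And>n. n \<in> F \<Longrightarrow> c \<le> norm (fourier h (2 * pi * real n / T))"
  shows "c\<^sup>2 * (\<Sum>n\<in>F. (norm (\<Sum>i\<in>I. of_real (a i) * iexp (- (2 * pi * real n / T * t i))))\<^sup>2)
    \<le> 2 * T\<^sup>2 * M\<^sup>2 + 2 * real (card F) * (\<delta> * (\<Sum>i\<in>I. \<bar>a i\<bar>))\<^sup>2"
proof -
  define H where "H = (\<lambda>s. \<Sum>i\<in>I. a i * h (s - t i))"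
  define E where "E = (\<lambda>n. \<Sum>i\<in>I. of_real (a i) * iexp (- (2 * pi * real n / T * t i)))"
  define d where "d = (\<lambda>n::nat. integral {- W..T - W} (\<lambda>s. of_real (H s) * iexp (- (2 * pi * real n / T * s))))"
  define D where "D = \<delta> * (\<Sum>i\<in>I. \<bar>a i\<bar>)"
  have "continuous_on UNIV (\<lambda>s. h (s - v))" for v
    by (rule continuous_on_compose2[OF cont]) (auto intro!: continuous_intros)
  then have "continuous_on UNIV H" unfolding H_def by (intro continuous_intros)
  then have bessel: "(\<Sum>n\<in>F. (norm (d n))\<^sup>2) \<le> T\<^sup>2 * M\<^sup>2"
    using bessel_inequality_interval[OF T, of H F "- W" M] F M by (simp add: d_def H_def)
  have each: "(c * norm (E n))\<^sup>2 \<le> 2 * (norm (d n))\<^sup>2 + 2 * D\<^sup>2" if n: "n \<in> F" for n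
  proof -
    have "c * norm (E n) \<le> norm (fourier h (2 * pi * real n / T) * E n)"
      unfolding norm_mult by (intro mult_right_mono c n) simp
    also have "\<dots> \<le> norm (d n) + norm (d n - fourier h (2 * pi * real n / T) * E n)"
      by (metis norm_minus_commute norm_triangle_sub)
    also have "norm (d n - fourier h (2 * pi * real n / T) * E n) \<le> D"
      unfolding d_def E_def D_def H_def by (rule windowed_fourier_translates[OF I cont h t \<delta>])
    finally have "(c * norm (E n))\<^sup>2 \<le> (norm (d n) + D)\<^sup>2"
      using c by (intro power_mono) auto
    also have "\<dots> \<le> 2 * (norm (d n))\<^sup>2 + 2 * D\<^sup>2"
      using zero_le_power2[of "norm (d n) - D"] by (simp add: power2_eq_square algebra_simps)
    finally show ?thesis .
  qed
  have "c\<^sup>2 * (\<Sum>n\<in>F. (norm (E n))\<^sup>2) = (\<Sum>n\<in>F. (c * norm (E n))\<^sup>2)"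
    by (simp add: sum_distrib_left power_mult_distrib)
  also have "\<dots> \<le> (\<Sum>n\<in>F. 2 * (norm (d n))\<^sup>2 + 2 * D\<^sup>2)"
    by (intro sum_mono each)
  also have "\<dots> = 2 * (\<Sum>n\<in>F. (norm (d n))\<^sup>2) + 2 * real (card F) * D\<^sup>2"
    by (simp add: sum.distrib sum_distrib_left)
  finally show ?thesis using bessel by (simp add: E_def D_def)
qed

subsection \<open>Exponential sums over grids\<close>

text \<open>Serves two averages: \<open>L\<close> is once a grid of directions and once a range of
  frequencies.\<close>

lemma parseval_finite:
  fixes e :: "'l \<Rightarrow> 'i \<Rightarrow> complex" and \<alpha> :: "'i \<Rightarrow> complex"
  assumes I: "finite I"
    and orth: "\<And>i j. i \<in> I \<Longrightarrow> j \<in> I \<Longrightarrow> (\<Sum>l\<in>L. e l i * cnj (e l j)) = (if i = j then of_real q else 0)"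
  shows "(\<Sum>l\<in>L. (norm (\<Sum>i\<in>I. \<alpha> i * e l i))\<^sup>2) = q * (\<Sum>i\<in>I. (norm (\<alpha> i))\<^sup>2)"
proof -
  have "complex_of_real (\<Sum>l\<in>L. (norm (\<Sum>i\<in>I. \<alpha> i * e l i))\<^sup>2)
      = (\<Sum>l\<in>L. \<Sum>i\<in>I. \<Sum>j\<in>I. \<alpha> i * cnj (\<alpha> j) * (e l i * cnj (e l j)))"
    unfolding of_real_sum complex_norm_square cnj_sum sum_product
    by (intro sum.cong) (simp_all add: mult_ac)
  also have "\<dots> = (\<Sum>i\<in>I. \<Sum>j\<in>I. \<Sum>l\<in>L. \<alpha> i * cnj (\<alpha> j) * (e l i * cnj (e l j)))"
    by (subst sum.swap, intro sum.cong refl, rule sum.swap)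
  also have "\<dots> = (\<Sum>i\<in>I. \<Sum>j\<in>I. \<alpha> i * cnj (\<alpha> j) * (if i = j then of_real q else 0))"
    by (intro sum.cong refl) (simp only: orth flip: sum_distrib_left)
  also have "\<dots> = (\<Sum>i\<in>I. of_real q * (\<alpha> i * cnj (\<alpha> i)))"
    using I by (intro sum.cong refl) (simp add: if_distrib mult_ac cong: if_cong)
  also have "\<dots> = complex_of_real (q * (\<Sum>i\<in>I. (norm (\<alpha> i))\<^sup>2))"
    unfolding of_real_mult of_real_sum complex_norm_square sum_distrib_left ..
  finally show ?thesis by (simp only: of_real_eq_iff)
qed

text \<open>A geometric sum of a nontrivial \<open>q\<close>-th root of unity over \<open>q\<close>
  consecutive exponents. The start is arbitrary because the frequencies in use form a range away
  from 0.\<close>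

lemma roots_of_unity_orthogonal:
  fixes i j q n\<^sub>0 :: nat
  assumes "i < q" "j < q"
  shows "(\<Sum>n\<in>{n\<^sub>0..<n\<^sub>0 + q}. iexp (- (2 * pi * n * i / q)) * cnj (iexp (- (2 * pi * n * j / q))))
    = (if i = j then of_real (real q) else 0)"
proof -
  define w where "w = iexp (2 * pi * (real j - real i) / q)"
  have q: "q > 0" using assms by simp
  have "iexp (- (2 * pi * n * i / q)) * cnj (iexp (- (2 * pi * n * j / q))) = w ^ n" for n
    unfolding w_def exp_cnj exp_of_nat_mult[symmetric] exp_add[symmetric]
    by (rule arg_cong[where f = exp]) (use q in \<open>simp add: field_simps\<close>)
  then have eq: "(\<Sum>n\<in>{n\<^sub>0..<n\<^sub>0 + q}. iexp (- (2 * pi * n * i / q)) * cnj (iexp (- (2 * pi * n * j / q))))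
      = (\<Sum>n\<in>{n\<^sub>0..<n\<^sub>0 + q}. w ^ n)" by simp
  show ?thesis
  proof (cases "i = j")
    case True
    then have "w = 1" by (simp add: w_def)
    then show ?thesis using True eq by simp
  next
    case False
    have wq: "w ^ q = 1"
    proof -
      have "w ^ q = exp ((2 * of_int (int j - int i) * pi) * \<i>)"
        unfolding w_def exp_of_nat_mult[symmetric]
        by (rule arg_cong[where f = exp]) (use q in \<open>simp add: field_simps\<close>)
      then show ?thesis using exp_integer_2pi[of "of_int (int j - int i)"] by simp
    qed
    have "w \<noteq> 1"
    proof
      assume "w = 1"
      then obtain N :: int where "2 * pi * (real j - real i) / q = of_int (2 * N) * pi"
        unfolding w_def exp_eq_1 by auto
      then have "pi * (real j - real i) = pi * (of_int N * q)" using q by (simp add: field_simps)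
      then have "real j - real i = of_int N * q" by simp
      then have "real_of_int (int j - int i) = real_of_int (N * int q)" by simp
      then have "int j - int i = N * int q" by (simp only: of_int_eq_iff)
      moreover have "\<bar>int j - int i\<bar> < int q" using assms by simp
      ultimately have "\<bar>N\<bar> * int q < 1 * int q" by (simp add: abs_mult)
      then have "N = 0" using q by (simp add: mult_less_cancel_right)
      then show False using \<open>int j - int i = N * int q\<close> False by simp
    qed
    have "(\<Sum>n\<in>{n\<^sub>0..<n\<^sub>0 + q}. w ^ n) = (\<Sum>n<q. w ^ n) * w ^ n\<^sub>0"
      using sum.shift_bounds_nat_ivl[of "\<lambda>n. w ^ n" 0 n\<^sub>0 q]
      by (simp add: power_add sum_distrib_right add.commute atLeast0LessThan)
    also have "(\<Sum>n<q. w ^ n) = 0" using \<open>w \<noteq> 1\<close> wq by (simp add: sum_gp_strict)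
    finally show ?thesis using False eq by simp
  qed
qed

text \<open>The sum factors over the coordinates; \<open>k \<le> q\<close> makes distinct coordinate
  values incongruent modulo \<open>q\<close>.\<close>

lemma roots_of_unity_orthogonal_PiE:
  fixes J :: "'j set" and q k :: nat
  assumes J: "finite J" and kq: "k \<le> q" and q: "q > 0"
    and i: "i \<in> J \<rightarrow>\<^sub>E {..<k}" "i' \<in> J \<rightarrow>\<^sub>E {..<k}"
  shows "(\<Sum>l\<in>J \<rightarrow>\<^sub>E {..<q}. iexp (- (\<Sum>j\<in>J. 2 * pi * l j * i j / q)) *
      cnj (iexp (- (\<Sum>j\<in>J. 2 * pi * l j * i' j / q))))
    = (if i = i' then of_real (real q ^ card J) else 0)"
proof -
  have "iexp (- (\<Sum>j\<in>J. 2 * pi * l j * i j / q)) * cnj (iexp (- (\<Sum>j\<in>J. 2 * pi * l j * i' j / q)))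
      = (\<Prod>j\<in>J. iexp (- (2 * pi * l j * i j / q)) * cnj (iexp (- (2 * pi * l j * i' j / q))))" for l :: "'j \<Rightarrow> nat"
    unfolding prod.distrib exp_cnj using J
    by (simp add: exp_sum[symmetric] sum_negf sum_distrib_left of_real_sum)
  then have "(\<Sum>l\<in>J \<rightarrow>\<^sub>E {..<q}. iexp (- (\<Sum>j\<in>J. 2 * pi * l j * i j / q)) *
      cnj (iexp (- (\<Sum>j\<in>J. 2 * pi * l j * i' j / q))))
    = (\<Prod>j\<in>J. \<Sum>n<q. iexp (- (2 * pi * n * i j / q)) * cnj (iexp (- (2 * pi * n * i' j / q))))"
    using J by (simp add: prod_sum_PiE)
  also have "\<dots> = (\<Prod>j\<in>J. if i j = i' j then of_real (real q) else 0)"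
  proof (rule prod.cong[OF refl])
    fix j assume "j \<in> J"
    then have "i j < q" "i' j < q" using i kq by (force simp: PiE_iff)+
    then show "(\<Sum>n<q. iexp (- (2 * pi * n * i j / q)) * cnj (iexp (- (2 * pi * n * i' j / q))))
        = (if i j = i' j then of_real (real q) else 0)"
      using roots_of_unity_orthogonal[of "i j" q "i' j" 0] by (simp only: atLeast0LessThan add_0)
  qed
  also have "\<dots> = (if i = i' then of_real (real q ^ card J) else 0)"
  proof (cases "i = i'")
    case False
    then obtain j where "j \<in> J" "i j \<noteq> i' j" using i by (metis PiE_ext)
    then show ?thesis using False J by (auto intro!: prod_zero)
  qed simp
  finally show ?thesis .
qed

text \<open>Directions \<open>z\<close> range over a finite grid. At frequency \<open>n\<close>,
  Parseval on a subgrid of side \<open>Q div n\<close> separates the coordinates in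
  \<open>J\<close>; summing over \<open>P\<close> consecutive frequencies then separates the first
  coordinate. Some direction attains the average.\<close>

lemma exists_direction_large_exponential_sums:
  fixes J :: "'j set" and a :: "nat \<times> ('j \<Rightarrow> nat) \<Rightarrow> real" and k P \<kappa> :: nat and b :: real
  assumes J: "finite J" and k: "0 < k" "k \<le> P" and \<kappa>: "\<kappa> > 0" and b: "b > 0"
  shows "\<exists>z :: 'j \<Rightarrow> real. (\<forall>j\<in>J. 0 \<le> z j \<and> z j \<le> b / \<kappa>) \<and>
    real P / 2 ^ card J * (\<Sum>i\<in>{..<k} \<times> (J \<rightarrow>\<^sub>E {..<k}). (a i)\<^sup>2) \<le>
      (\<Sum>n\<in>{\<kappa> * P..<\<kappa> * P + P}. (norm (\<Sum>i\<in>{..<k} \<times> (J \<rightarrow>\<^sub>E {..<k}). of_real (a i) *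
        iexp (- (2 * pi * real n / (b * P) * (b * real (fst i) + (\<Sum>j\<in>J. z j * real (snd i j)))))))\<^sup>2)"
proof -
  \<comment> \<open>\<open>Q\<close> is a multiple of every frequency \<open>n\<close> in the window, so for each such \<open>n\<close> the grid of
    directions contains a complete system of roots of unity of order \<open>Q div n\<close> in every coordinate.\<close>
  define Q where "Q = k * fact ((\<kappa> + 1) * P)"
  define \<Gamma> where "\<Gamma> = Q div (\<kappa> * P)"
  define F where "F = {\<kappa> * P..<\<kappa> * P + P}"
  define I' where "I' = (J \<rightarrow>\<^sub>E {..<k} :: ('j \<Rightarrow> nat) set)"
  define z where "z = (\<lambda>(l :: 'j \<Rightarrow> nat) j. real P * b * l j / Q)"
  define E where "E = (\<lambda>(l :: 'j \<Rightarrow> nat) n. \<Sum>i\<in>{..<k} \<times> I'. of_real (a i) *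
        iexp (- (2 * pi * real n / (b * P) * (b * real (fst i) + (\<Sum>j\<in>J. z l j * real (snd i j))))))"
  define Y where "Y = (\<Sum>i\<in>{..<k} \<times> I'. (a i)\<^sup>2)"
  have P: "P > 0" using k by simp
  have Q: "Q > 0" using k by (simp add: Q_def)
  \<comment> \<open>The factor \<open>k\<close> of \<open>Q\<close> makes every
    \<open>Q div n\<close> at least \<open>k\<close>, as orthogonality on coordinates below
    \<open>k\<close> requires.\<close>
  have dvd: "k \<le> Q div n" "n * (Q div n) = Q" if "0 < n" "n \<le> (\<kappa> + 1) * P" for n
  proof -
    have "n dvd fact ((\<kappa> + 1) * P)" using that by (intro dvd_fact) auto
    then have "Q div n = k * (fact ((\<kappa> + 1) * P) div n)" by (simp add: Q_def div_mult_swap)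
    moreover have "fact ((\<kappa> + 1) * P) div n > 0"
      using \<open>n dvd fact ((\<kappa> + 1) * P)\<close> that by (simp add: div_greater_zero_iff dvd_imp_le)
    ultimately show "k \<le> Q div n" by simp
    show "n * (Q div n) = Q" using \<open>n dvd fact ((\<kappa> + 1) * P)\<close> by (simp add: Q_def)
  qed
  have \<kappa>P: "0 < \<kappa> * P" "\<kappa> * P \<le> (\<kappa> + 1) * P" using \<kappa> P by auto
  have \<Gamma>: "\<Gamma> > 0" "\<kappa> * P * \<Gamma> = Q" using dvd[OF \<kappa>P] k by (auto simp: \<Gamma>_def)
  have fin: "finite I'" unfolding I'_def using J by (intro finite_PiE) auto
  have Fn: "0 < n" "n \<le> (\<kappa> + 1) * P" "\<kappa> * P \<le> n" if "n \<in> F" for n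
  proof -
    show "\<kappa> * P \<le> n" "n \<le> (\<kappa> + 1) * P" using that by (auto simp: F_def)
    then show "0 < n" using \<kappa>P(1) by linarith
  qed
  have lower: "(real \<Gamma> / 2) ^ card J * (\<Sum>i'\<in>I'. (norm (\<Sum>i1<k. of_real (a (i1, i')) *
      iexp (- (2 * pi * n * i1 / P))))\<^sup>2) \<le> (\<Sum>l\<in>J \<rightarrow>\<^sub>E {..<\<Gamma>}. (norm (E l n))\<^sup>2)" if n: "n \<in> F" for n
  proof -
    define q where "q = Q div n"
    have q: "n * q = Q" "k \<le> q" using dvd[OF Fn(1,2)[OF n]] by (auto simp: q_def)
    have q0: "q > 0" using q k by simp
    have qQ: "real n * real q = real Q" using q(1) by (metis of_nat_mult)
    have "q \<le> \<Gamma>" unfolding q_def \<Gamma>_def using Fn(3)[OF n] \<kappa>P by (intro div_le_mono2) auto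
    \<comment> \<open>Since \<open>\<kappa> \<ge> 1\<close>, the frequencies vary by a factor of at
      most 2, and so do the sides of the subgrids. This is the origin of the loss
      \<open>2 ^ card J\<close>.\<close>
    have "(\<kappa> * P) * \<Gamma> \<le> (\<kappa> * P) * (2 * q)"
    proof -
      have "n \<le> 2 * (\<kappa> * P)" using Fn(2)[OF n] \<kappa> by (cases \<kappa>) auto
      then have "n * q \<le> 2 * (\<kappa> * P) * q" by (rule mult_le_mono1)
      then show ?thesis using q(1) \<Gamma>(2) by (simp add: mult_ac)
    qed
    then have "\<Gamma> \<le> 2 * q" using \<kappa>P by (simp only: mult_le_cancel1)
    then have "real \<Gamma> / 2 \<le> real q" by linarith
    define A where "A = (\<lambda>i'. \<Sum>i1<k. of_real (a (i1, i')) * iexp (- (2 * pi * n * i1 / P)))"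
    have E_eq: "E l n = (\<Sum>i'\<in>I'. A i' * iexp (- (\<Sum>j\<in>J. 2 * pi * l j * i' j / q)))" for l
    proof -
      have ph: "2 * pi * real n / (b * P) * (b * i1 + (\<Sum>j\<in>J. z l j * i' j))
          = 2 * pi * n * i1 / P + (\<Sum>j\<in>J. 2 * pi * l j * i' j / q)" for i1 :: nat and i' :: "'j \<Rightarrow> nat"
      proof -
        have "2 * pi * real n / (b * P) * (z l j * i' j) = 2 * pi * l j * i' j / q" for j
          using b P Q q0 qQ Fn(1)[OF n] by (simp add: z_def divide_simps flip: qQ)
        then show ?thesis
          using b P by (simp add: distrib_left sum_distrib_left)
      qed
      have "E l n = (\<Sum>i1<k. \<Sum>i'\<in>I'. of_real (a (i1, i')) *
          (iexp (- (2 * pi * n * i1 / P)) * iexp (- (\<Sum>j\<in>J. 2 * pi * l j * i' j / q))))"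
        unfolding E_def sum.cartesian_product'
        by (simp only: fst_conv snd_conv ph) (simp only: minus_add_distrib of_real_add distrib_left exp_add)
      also have "\<dots> = (\<Sum>i'\<in>I'. A i' * iexp (- (\<Sum>j\<in>J. 2 * pi * l j * i' j / q)))"
        unfolding A_def sum_distrib_right by (subst sum.swap) (simp only: mult.assoc)
      finally show ?thesis .
    qed
    have "(real \<Gamma> / 2) ^ card J * (\<Sum>i'\<in>I'. (norm (A i'))\<^sup>2) \<le> real q ^ card J * (\<Sum>i'\<in>I'. (norm (A i'))\<^sup>2)"
      using \<open>real \<Gamma> / 2 \<le> real q\<close> by (intro mult_right_mono power_mono sum_nonneg) auto
    also have "\<dots> = (\<Sum>l\<in>J \<rightarrow>\<^sub>E {..<q}. (norm (E l n))\<^sup>2)"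
      unfolding E_eq
      by (rule parseval_finite[OF fin, symmetric])
         (unfold I'_def, rule roots_of_unity_orthogonal_PiE[OF J q(2) q0])
    also have "\<dots> \<le> (\<Sum>l\<in>J \<rightarrow>\<^sub>E {..<\<Gamma>}. (norm (E l n))\<^sup>2)"
      using J \<open>q \<le> \<Gamma>\<close> by (intro sum_mono2 finite_PiE PiE_mono) auto
    finally show ?thesis unfolding A_def .
  qed
  \<comment> \<open>Parseval in the first coordinate: the \<open>P \<ge> k\<close> frequencies are
    consecutive integers.\<close>
  have "(real \<Gamma> / 2) ^ card J * (real P * Y) = (\<Sum>n\<in>F. (real \<Gamma> / 2) ^ card J *
      (\<Sum>i'\<in>I'. (norm (\<Sum>i1<k. of_real (a (i1, i')) * iexp (- (2 * pi * n * i1 / P))))\<^sup>2))"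
  proof -
    have "(\<Sum>n\<in>F. (norm (\<Sum>i1<k. of_real (a (i1, i')) * iexp (- (2 * pi * n * i1 / P))))\<^sup>2)
        = real P * (\<Sum>i1<k. (norm (complex_of_real (a (i1, i'))))\<^sup>2)" for i'
      unfolding F_def
      by (intro parseval_finite finite_lessThan roots_of_unity_orthogonal) (use k in auto)
    then have "(\<Sum>i'\<in>I'. \<Sum>n\<in>F. (norm (\<Sum>i1<k. of_real (a (i1, i')) * iexp (- (2 * pi * n * i1 / P))))\<^sup>2)
        = real P * Y"
      unfolding Y_def sum.cartesian_product'
      by (subst (2) sum.swap) (simp add: sum_distrib_left)
    then show ?thesis
      unfolding sum_distrib_left[symmetric] by (subst sum.swap) simp
  qed
  also have "\<dots> \<le> (\<Sum>n\<in>F. \<Sum>l\<in>J \<rightarrow>\<^sub>E {..<\<Gamma>}. (norm (E l n))\<^sup>2)"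
    by (intro sum_mono lower)
  also have "\<dots> = (\<Sum>l\<in>J \<rightarrow>\<^sub>E {..<\<Gamma>}. \<Sum>n\<in>F. (norm (E l n))\<^sup>2)"
    by (rule sum.swap)
  finally have total: "(real \<Gamma> / 2) ^ card J * (real P * Y) \<le> (\<Sum>l\<in>J \<rightarrow>\<^sub>E {..<\<Gamma>}. \<Sum>n\<in>F. (norm (E l n))\<^sup>2)" .
  \<comment> \<open>The grid has \<open>\<Gamma> ^ card J\<close> directions, so dividing by this
    number leaves the claimed average.\<close>
  have "\<exists>l\<in>J \<rightarrow>\<^sub>E {..<\<Gamma>}. real P / 2 ^ card J * Y \<le> (\<Sum>n\<in>F. (norm (E l n))\<^sup>2)"
  proof (rule ccontr)
    assume "\<not> ?thesis"
    then have "(\<Sum>l\<in>J \<rightarrow>\<^sub>E {..<\<Gamma>}. \<Sum>n\<in>F. (norm (E l n))\<^sup>2) < (\<Sum>l\<in>J \<rightarrow>\<^sub>E {..<\<Gamma>}. real P / 2 ^ card J * Y)"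
      using J \<Gamma> by (intro sum_strict_mono finite_PiE) (auto simp: not_le PiE_eq_empty_iff)
    also have "\<dots> = (real \<Gamma> / 2) ^ card J * (real P * Y)"
      using J by (simp add: card_PiE power_divide)
    finally show False using total by simp
  qed
  then obtain l where l: "l \<in> J \<rightarrow>\<^sub>E {..<\<Gamma>}" "real P / 2 ^ card J * Y \<le> (\<Sum>n\<in>F. (norm (E l n))\<^sup>2)" by blast
  show ?thesis
  proof (intro exI[of _ "z l"] conjI ballI)
    fix j assume j: "j \<in> J"
    show "0 \<le> z l j" using b by (simp add: z_def)
    have "l j \<le> \<Gamma>" using l j by (force simp: PiE_iff)
    then have "real P * b * l j / Q \<le> real P * b * \<Gamma> / Q"
      using b by (intro divide_right_mono mult_left_mono) auto
    also have "\<dots> = b / \<kappa>"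
      using P \<kappa> \<Gamma>(1) by (simp flip: \<Gamma>(2))
    finally show "z l j \<le> b / \<kappa>" by (simp add: z_def)
  next
    show "real P / 2 ^ card J * (\<Sum>i\<in>{..<k} \<times> (J \<rightarrow>\<^sub>E {..<k}). (a i)\<^sup>2) \<le>
      (\<Sum>n\<in>{\<kappa> * P..<\<kappa> * P + P}. (norm (\<Sum>i\<in>{..<k} \<times> (J \<rightarrow>\<^sub>E {..<k}). of_real (a i) *
        iexp (- (2 * pi * real n / (b * P) * (b * real (fst i) + (\<Sum>j\<in>J. z l j * real (snd i j)))))))\<^sup>2)"
      using l(2) by (simp only: Y_def F_def E_def I'_def)
  qed
qed

subsection \<open>Large values of sums of absolute powers\<close>

lemma integrable_inverse_1_plus_square_lborel: "integrable lborel (\<lambda>x::real. inverse (1 + x\<^sup>2))"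
  using integrable_inverse_1_plus_square by (simp add: set_integrable_def)

lemma decay_imp_integrable:
  fixes h :: "real \<Rightarrow> real"
  assumes cont: "continuous_on UNIV h" and B: "\<And>t. (1 + t\<^sup>2) * \<bar>h t\<bar> \<le> B"
  shows "integrable lborel h"
proof (rule Bochner_Integration.integrable_bound)
  show "integrable lborel (\<lambda>x. B * inverse (1 + x\<^sup>2))"
    by (intro integrable_mult_right integrable_inverse_1_plus_square_lborel)
  show "h \<in> borel_measurable lborel" using borel_measurable_continuous_onI[OF cont] by simp
  have "\<bar>h t\<bar> \<le> B * inverse (1 + t\<^sup>2)" for t
    using B[of t] by (simp add: field_simps add_pos_nonneg)
  then show "AE t in lborel. norm (h t) \<le> norm (B * inverse (1 + t\<^sup>2))"
    by (auto intro!: AE_I2 order_trans[OF _ abs_ge_self])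
qed

text \<open>Beyond \<open>W\<close> the factor \<open>\<bar>t\<bar> ^ m\<close> of the weight is at
  least \<open>W ^ m\<close>, and the other factor keeps the bound integrable.\<close>

lemma decay_imp_tail_integral_le:
  fixes h :: "real \<Rightarrow> real"
  assumes h: "integrable lborel h" and B: "\<And>t. (1 + t\<^sup>2) * \<bar>t\<bar> ^ m * \<bar>h t\<bar> \<le> B" and W: "W > 0"
  shows "(\<integral>s. indicator {s. \<bar>s\<bar> \<ge> W} s * \<bar>h s\<bar> \<partial>lborel)
    \<le> B * (\<integral>s. inverse (1 + s\<^sup>2) \<partial>lborel) / W ^ m"
proof -
  have hm[measurable]: "h \<in> borel_measurable borel" using h by auto
  have "B \<ge> 0" using order_trans[OF _ B[of 0]] by simp
  have "(\<integral>s. indicator {s. \<bar>s\<bar> \<ge> W} s * \<bar>h s\<bar> \<partial>lborel) \<le> (\<integral>s. B / W ^ m * inverse (1 + s\<^sup>2) \<partial>lborel)"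
  proof (rule integral_mono)
    show "integrable lborel (\<lambda>s. indicator {s. \<bar>s\<bar> \<ge> W} s * \<bar>h s\<bar>)"
      by (rule Bochner_Integration.integrable_bound[OF h]) (auto simp: indicator_def)
    show "integrable lborel (\<lambda>s. B / W ^ m * inverse (1 + s\<^sup>2))"
      by (intro integrable_mult_right integrable_inverse_1_plus_square_lborel)
    fix s :: real
    show "indicator {s. \<bar>s\<bar> \<ge> W} s * \<bar>h s\<bar> \<le> B / W ^ m * inverse (1 + s\<^sup>2)"
    proof (cases "\<bar>s\<bar> \<ge> W")
      case True
      have "(1 + s\<^sup>2) * W ^ m * \<bar>h s\<bar> \<le> (1 + s\<^sup>2) * \<bar>s\<bar> ^ m * \<bar>h s\<bar>"
        using True W by (intro mult_right_mono mult_left_mono power_mono) auto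
      also have "\<dots> \<le> B" by (rule B)
      finally have "\<bar>h s\<bar> * (W ^ m * (1 + s\<^sup>2)) \<le> B" by (simp add: mult_ac)
      then have "\<bar>h s\<bar> \<le> B / (W ^ m * (1 + s\<^sup>2))"
        using W by (subst pos_le_divide_eq) (auto simp: add_pos_nonneg)
      then show ?thesis using True by (simp add: divide_inverse mult_ac)
    next
      case False
      then show ?thesis using \<open>B \<ge> 0\<close> W by simp
    qed
  qed
  then show ?thesis by simp
qed

text \<open>If the sum stayed below \<open>M\<close> on the window, the exponential sums would have
  total energy of order at most \<open>T\<^sup>2 * M\<^sup>2\<close>, up to the truncation error.
  The chosen direction has energy of order \<open>P * k ^ m\<close>. As \<open>T\<close> and
  \<open>P\<close> are of order \<open>k\<close>, this forces \<open>M\<close> to be at least of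
  order \<open>k\<close> to the power \<open>(m - 1) / 2\<close>.\<close>

lemma exists_direction_large_lp_sum:
  fixes p :: real and J :: "'j set"
  assumes p: "p > 0" "\<not> (\<exists>k::int. p = 2 * of_int k)" and J: "finite J"
  shows "\<exists>c::real>0. \<exists>C::real>0. \<exists>k\<^sub>0. \<forall>k\<ge>k\<^sub>0. \<forall>a :: nat \<times> ('j \<Rightarrow> nat) \<Rightarrow> real. (\<forall>i. \<bar>a i\<bar> \<le> 1) \<longrightarrow>
    real (k ^ Suc (card J)) / 16 \<le> (\<Sum>i\<in>{..<k} \<times> (J \<rightarrow>\<^sub>E {..<k}). (a i)\<^sup>2) \<longrightarrow>
    (\<exists>y z s. (\<forall>i\<in>{..<k} \<times> (J \<rightarrow>\<^sub>E {..<k}). \<bar>y * real (fst i) + (\<Sum>j\<in>J. z j * real (snd i j)) - s\<bar> \<le> C * real k) \<and>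
      c * sqrt (real k ^ card J) \<le> \<bar>\<Sum>i\<in>{..<k} \<times> (J \<rightarrow>\<^sub>E {..<k}).
        a i * \<bar>y * real (fst i) + (\<Sum>j\<in>J. z j * real (snd i j)) - s\<bar> powr p\<bar>)"
proof -
  define m where "m = Suc (card J)"
  \<comment> \<open>This order leaves decay \<open>\<bar>t\<bar> ^ m\<close> beyond integrability:
    the tail past a distance of order \<open>k\<close> is then of order \<open>1 / k ^ m\<close>,
    which offsets the up to \<open>k ^ m\<close> coefficients.\<close>
  define r where "r = nat \<lceil>p\<rceil> + m + 2"
  have r: "real r \<ge> p + real m + 2" by (simp add: r_def) linarith
  define h where "h = fdiff r (\<lambda>u. \<bar>u\<bar> powr p)"
  have cont: "continuous_on UNIV h"
    unfolding h_def by (intro continuous_on_fdiff continuous_on_abs_powr p)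
  obtain B where B: "\<And>t. (1 + t\<^sup>2) * \<bar>t\<bar> ^ m * \<bar>h t\<bar> \<le> B"
    using fdiff_abs_powr_decay[OF p(1) r] unfolding h_def by blast
  have r0: "real r \<ge> p + real 0 + 2" using r by simp
  obtain B\<^sub>0 where "\<And>t. (1 + t\<^sup>2) * \<bar>t\<bar> ^ 0 * \<bar>h t\<bar> \<le> B\<^sub>0"
    using fdiff_abs_powr_decay[OF p(1) r0] unfolding h_def by blast
  then have int: "integrable lborel h"
    using decay_imp_integrable[OF cont, of B\<^sub>0] by simp
  have "real r > p" using r by simp
  then obtain t\<^sub>0 where nz: "h t\<^sub>0 \<noteq> 0"
    unfolding h_def using fdiff_abs_powr_nonzero[OF p] by blast
  obtain \<alpha> \<rho> c\<^sub>0 where band: "\<alpha> > 0" "\<rho> > 0" "c\<^sub>0 > 0"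
    "\<And>\<tau>. \<alpha> \<le> \<tau> \<Longrightarrow> \<tau> \<le> \<alpha> + \<rho> \<Longrightarrow> c\<^sub>0 \<le> norm (fourier h \<tau>)"
    using fourier_bounded_below_on_interval[OF cont int nz] by metis
  \<comment> \<open>The frequencies \<open>2 * pi * n / T\<close> with \<open>\<kappa> * P \<le> n < \<kappa> * P + P\<close> fill \<open>[\<alpha>, \<alpha> + \<alpha> / \<kappa>)\<close>, an
    interval on which the Fourier transform is bounded below and whose length is a full period
    \<open>2 * pi / b\<close> of the exponential sums over a grid of mesh \<open>b\<close>.\<close>
  define \<kappa> where "\<kappa> = nat \<lceil>\<alpha> / \<rho>\<rceil>"
  have "\<alpha> / \<rho> > 0" using band by simp
  then have \<kappa>: "\<kappa> > 0" unfolding \<kappa>_def by simp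
  have "\<alpha> / \<rho> \<le> real \<kappa>" unfolding \<kappa>_def by linarith
  then have \<kappa>\<rho>: "\<alpha> / \<kappa> \<le> \<rho>" using band \<kappa> by (simp add: field_simps)
  \<comment> \<open>With \<open>T = b * P\<close> the lowest frequency
    \<open>2 * pi * (\<kappa> * P) / T\<close> is exactly \<open>\<alpha>\<close>.\<close>
  define b where "b = 2 * pi * \<kappa> / \<alpha>"
  have b: "b > 0" using band \<kappa> by (simp add: b_def)
  \<comment> \<open>\<open>D / k ^ m\<close> will bound the tail beyond \<open>W = b * k\<close>, so
    the truncation error of the whole sum is at most \<open>D\<close>.\<close>
  define D where "D = B * (\<integral>s. inverse (1 + s\<^sup>2) \<partial>lborel) / b ^ m"
  define \<gamma> where "\<gamma> = c\<^sub>0\<^sup>2 / (16 * 2 ^ card J)"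
  have \<gamma>: "\<gamma> > 0" using band by (simp add: \<gamma>_def)
  \<comment> \<open>Chosen with \<open>c\<close> so that the supremum term
    \<open>2 * T\<^sup>2 * (2 ^ r * M)\<^sup>2\<close> equals a quarter of the lower bound
    \<open>P * (\<gamma> * k ^ m)\<close>; \<open>k\<^sub>0\<close> pushes the truncation term below
    half of it.\<close>
  define N where "N = 8 * b\<^sup>2 * (m + 2) * 4 ^ r"
  have N: "N > 0" using b by (simp add: N_def)
  define c where "c = sqrt (\<gamma> / N)"
  define C where "C = 2 * b * (m + 2) + r"
  define k\<^sub>0 where "k\<^sub>0 = Suc (nat \<lceil>4 * D\<^sup>2 / \<gamma>\<rceil>)"
  show ?thesis
  proof (rule exI[of _ c], rule conjI[rotated], rule exI[of _ C], rule conjI[rotated], rule exI[of _ k\<^sub>0],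
      intro allI impI)
    show "c > 0" using \<gamma> N by (simp add: c_def)
    show "C > 0" using b by (simp add: C_def add_pos_nonneg)
  next
    fix k :: nat and a :: "nat \<times> ('j \<Rightarrow> nat) \<Rightarrow> real"
    define I where "I = {..<k} \<times> (J \<rightarrow>\<^sub>E {..<k})"
    assume k: "k \<ge> k\<^sub>0" and a1: "\<forall>i. \<bar>a i\<bar> \<le> 1"
      and a2: "real (k ^ Suc (card J)) / 16 \<le> (\<Sum>i\<in>{..<k} \<times> (J \<rightarrow>\<^sub>E {..<k}). (a i)\<^sup>2)"
    have a2': "real k ^ m / 16 \<le> (\<Sum>i\<in>I. (a i)\<^sup>2)" using a2 by (simp add: I_def m_def)
    have k1: "k \<ge> 1" using k by (simp add: k\<^sub>0_def)
    have "4 * D\<^sup>2 / \<gamma> < real k" using k unfolding k\<^sub>0_def by linarith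
    then have kD: "4 * D\<^sup>2 < \<gamma> * real k ^ m"
    proof -
      have "real k ^ 1 \<le> real k ^ m" using k1 by (intro power_increasing) (auto simp: m_def)
      with \<open>4 * D\<^sup>2 / \<gamma> < real k\<close> have "4 * D\<^sup>2 / \<gamma> < real k ^ m"
        unfolding power_one_right by (rule less_le_trans)
      then show ?thesis using \<gamma> by (simp add: field_simps)
    qed
    have finI: "finite I" unfolding I_def using J by (intro finite_cartesian_product finite_PiE) auto
    have cardI: "card I = k ^ m" using J by (simp add: I_def m_def card_cartesian_product card_PiE)
    \<comment> \<open>Each of the \<open>m\<close> coordinates contributes at most
      \<open>b * k\<close> to \<open>t i\<close>; the extra 2 provides a margin
      \<open>W = b * k\<close> at both ends of the window.\<close>
    define P where "P = (m + 2) * k"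
    define T where "T = b * P"
    define W where "W = b * k"
    have P: "k \<le> P" "P > 0" using k1 by (auto simp: P_def)
    have T: "T > 0" and W: "W > 0" using b P k1 by (auto simp: T_def W_def)
    have "\<exists>z. (\<forall>j\<in>J. 0 \<le> z j \<and> z j \<le> b / \<kappa>) \<and> real P / 2 ^ card J * (\<Sum>i\<in>I. (a i)\<^sup>2) \<le>
      (\<Sum>n\<in>{\<kappa> * P..<\<kappa> * P + P}. (norm (\<Sum>i\<in>I. of_real (a i) *
        iexp (- (2 * pi * real n / T * (b * real (fst i) + (\<Sum>j\<in>J. z j * real (snd i j)))))))\<^sup>2)"
      unfolding I_def T_def using k1
      by (intro exists_direction_large_exponential_sums J P \<kappa> b) simp
    then obtain z where "\<forall>j\<in>J. 0 \<le> z j \<and> z j \<le> b / \<kappa>"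
      and large: "real P / 2 ^ card J * (\<Sum>i\<in>I. (a i)\<^sup>2) \<le>
      (\<Sum>n\<in>{\<kappa> * P..<\<kappa> * P + P}. (norm (\<Sum>i\<in>I. of_real (a i) *
        iexp (- (2 * pi * real n / T * (b * real (fst i) + (\<Sum>j\<in>J. z j * real (snd i j)))))))\<^sup>2)"
      by (elim exE conjE)
    then have z: "\<And>j. j \<in> J \<Longrightarrow> 0 \<le> z j" "\<And>j. j \<in> J \<Longrightarrow> z j \<le> b / \<kappa>"
      by simp_all
    define t where "t = (\<lambda>i :: nat \<times> ('j \<Rightarrow> nat). b * real (fst i) + (\<Sum>j\<in>J. z j * real (snd i j)))"
    have t0: "0 \<le> t i" for i
      unfolding t_def using b z by (intro add_nonneg_nonneg sum_nonneg mult_nonneg_nonneg) auto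
    have t1: "t i + 2 * W \<le> T" if "i \<in> I" for i
    proof -
      have "fst i \<le> k" "\<And>j. j \<in> J \<Longrightarrow> snd i j \<le> k"
        using that by (auto simp: I_def PiE_iff less_imp_le)
      moreover have "b / \<kappa> \<le> b" using b \<kappa> by (simp add: field_simps)
      ultimately have "b * real (fst i) \<le> b * k" "\<And>j. j \<in> J \<Longrightarrow> z j * real (snd i j) \<le> b * k"
        using b z by (auto intro!: mult_mono intro: order_trans)
      then have "t i \<le> b * k + (\<Sum>j\<in>J. b * k)"
        unfolding t_def by (intro add_mono sum_mono) auto
      then show ?thesis by (simp add: T_def W_def P_def m_def algebra_simps)
    qed
    define G where "G = (\<lambda>s. \<Sum>i\<in>I. a i * \<bar>s - t i\<bar> powr p)"
    define M where "M = c * sqrt (real k ^ card J)"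
    \<comment> \<open>The search range exceeds the window by \<open>r\<close> because the difference
      at \<open>s\<close> samples \<open>G\<close> up to \<open>s + r\<close>.\<close>
    have "\<exists>s\<in>{- W..T - W + r}. M \<le> \<bar>G s\<bar>"
    proof (rule ccontr)
      assume "\<not> ?thesis"
      then have small: "\<bar>G s\<bar> \<le> M" if "s \<in> {- W..T - W + r}" for s using that by force
      have H: "\<bar>\<Sum>i\<in>I. a i * h (s - t i)\<bar> \<le> 2 ^ r * M" if s: "s \<in> {- W..T - W}" for s
      proof -
        have "(\<Sum>i\<in>I. a i * h (s - t i)) = fdiff r G s"
          unfolding G_def h_def fdiff_sum fdiff_cmult
          by (intro sum.cong refl arg_cong2[where f = "(*)"] fdiff_shift[symmetric])
        then show ?thesis using s by (auto intro!: fdiff_bound small)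
      qed
      have tail: "(\<integral>s. indicator {s. \<bar>s\<bar> \<ge> W} s * \<bar>h s\<bar> \<partial>lborel) \<le> D / real k ^ m"
        using decay_imp_tail_integral_le[OF int B W] by (simp add: D_def W_def power_mult_distrib)
      have low: "c\<^sub>0 \<le> norm (fourier h (2 * pi * real n / T))" if "n \<in> {\<kappa> * P..<\<kappa> * P + P}" for n
      proof -
        have "2 * pi * real n / T = \<alpha> * (real n / (\<kappa> * P))"
          using band by (simp add: T_def b_def)
        moreover have "1 \<le> real n / (\<kappa> * P)" "real n / (\<kappa> * P) \<le> 1 + 1 / \<kappa>"
        proof -
          have "real (\<kappa> * P) \<le> real n" "real n \<le> real (\<kappa> * P + P)"
            using that by (auto simp del: of_nat_mult of_nat_add)
          then show "1 \<le> real n / (\<kappa> * P)" "real n / (\<kappa> * P) \<le> 1 + 1 / \<kappa>"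
            using \<kappa> P(2) by (auto simp: field_simps)
        qed
        ultimately have "\<alpha> \<le> 2 * pi * real n / T" "2 * pi * real n / T \<le> \<alpha> * (1 + 1 / \<kappa>)"
          using band(1) by (auto simp: mult_le_cancel_left1 simp del: times_divide_eq_right)
        then show ?thesis using \<kappa>\<rho> by (intro band) (auto simp: distrib_left)
      qed
      have "c\<^sub>0\<^sup>2 * (\<Sum>n\<in>{\<kappa> * P..<\<kappa> * P + P}. (norm (\<Sum>i\<in>I. of_real (a i) *
          iexp (- (2 * pi * real n / T * t i))))\<^sup>2)
        \<le> 2 * T\<^sup>2 * (2 ^ r * M)\<^sup>2 + 2 * real (card {\<kappa> * P..<\<kappa> * P + P}) * (D / real k ^ m * (\<Sum>i\<in>I. \<bar>a i\<bar>))\<^sup>2"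
        by (rule exponential_sums_le_sup[OF finI _ cont int T t0 t1 tail H _ low]) (use band in auto)
      also have "\<dots> \<le> 2 * T\<^sup>2 * (2 ^ r * M)\<^sup>2 + 2 * real P * D\<^sup>2"
      proof -
        have "(\<Sum>i\<in>I. \<bar>a i\<bar>) \<le> real k ^ m"
          using sum_mono[of I "\<lambda>i. \<bar>a i\<bar>" "\<lambda>_. 1"] a1 cardI by simp
        then have "\<bar>D / real k ^ m * (\<Sum>i\<in>I. \<bar>a i\<bar>)\<bar> \<le> \<bar>D / real k ^ m\<bar> * real k ^ m"
          unfolding abs_mult by (intro mult_left_mono) (auto simp: sum_nonneg)
        also have "\<dots> = \<bar>D\<bar>" using k1 by (simp add: abs_divide)
        finally have "(D / real k ^ m * (\<Sum>i\<in>I. \<bar>a i\<bar>))\<^sup>2 \<le> D\<^sup>2" by (simp only: abs_le_square_iff)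
        then show ?thesis by (simp add: mult_left_mono)
      qed
      finally have upper: "c\<^sub>0\<^sup>2 * (\<Sum>n\<in>{\<kappa> * P..<\<kappa> * P + P}. (norm (\<Sum>i\<in>I. of_real (a i) *
          iexp (- (2 * pi * real n / T * t i))))\<^sup>2) \<le> 2 * T\<^sup>2 * (2 ^ r * M)\<^sup>2 + 2 * real P * D\<^sup>2" .
      have "real P * (\<gamma> * real k ^ m) = c\<^sub>0\<^sup>2 * (real P / 2 ^ card J * (real k ^ m / 16))"
        by (simp add: \<gamma>_def mult_ac)
      also have "\<dots> \<le> c\<^sub>0\<^sup>2 * (real P / 2 ^ card J * (\<Sum>i\<in>I. (a i)\<^sup>2))"
        by (intro mult_left_mono a2') auto
      also have "\<dots> \<le> 2 * T\<^sup>2 * (2 ^ r * M)\<^sup>2 + 2 * real P * D\<^sup>2"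
        using mult_left_mono[OF large, of "c\<^sub>0\<^sup>2"] upper by (simp add: t_def)
      also have "2 * T\<^sup>2 * (2 ^ r * M)\<^sup>2 = real P * (\<gamma> / 4 * real k ^ m)"
      proof -
        have M2: "M\<^sup>2 = \<gamma> / N * real k ^ card J"
          using \<gamma> N by (simp add: M_def c_def power_mult_distrib)
        have "(2 ^ r)\<^sup>2 = (4 :: real) ^ r" by (simp add: power_mult[symmetric] mult.commute[of r] power_mult)
        then have "2 * T\<^sup>2 * (2 ^ r * M)\<^sup>2 = real P * (2 * b\<^sup>2 * P * 4 ^ r * (\<gamma> / N * real k ^ card J))"
          by (simp add: T_def power_mult_distrib M2) (simp add: power2_eq_square)
        also have "2 * b\<^sup>2 * P * 4 ^ r * (\<gamma> / N * real k ^ card J) = N / 4 * (\<gamma> / N) * real k ^ m"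
          by (simp add: N_def P_def m_def) (simp add: algebra_simps)
        finally show ?thesis using N by simp
      qed
      finally have "real P * (\<gamma> * real k ^ m) \<le> real P * (\<gamma> / 4 * real k ^ m + 2 * D\<^sup>2)"
        by (simp add: algebra_simps)
      then have "\<gamma> * real k ^ m \<le> \<gamma> / 4 * real k ^ m + 2 * D\<^sup>2" using P by simp
      then show False using kD zero_le_power2[of D] by simp
    qed
    then obtain s where s: "s \<in> {- W..T - W + r}" "M \<le> \<bar>G s\<bar>" by blast
    have "\<bar>t i - s\<bar> \<le> C * real k" if "i \<in> I" for i
    proof -
      have "\<bar>t i - s\<bar> \<le> 2 * T + r" using t0[of i] t1[OF that] s(1) W by auto
      also have "\<dots> \<le> 2 * T + real r * real k" using k1 by (simp add: mult_le_cancel_left1)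
      also have "\<dots> = C * real k" by (simp add: C_def T_def P_def algebra_simps)
      finally show ?thesis .
    qed
    moreover have "M \<le> \<bar>\<Sum>i\<in>I. a i * \<bar>t i - s\<bar> powr p\<bar>"
      using s(2) by (simp add: G_def abs_minus_commute)
    ultimately show "\<exists>y z s. (\<forall>i\<in>{..<k} \<times> (J \<rightarrow>\<^sub>E {..<k}). \<bar>y * real (fst i) + (\<Sum>j\<in>J. z j * real (snd i j)) - s\<bar> \<le> C * real k) \<and>
        c * sqrt (real k ^ card J) \<le> \<bar>\<Sum>i\<in>{..<k} \<times> (J \<rightarrow>\<^sub>E {..<k}).
          a i * \<bar>y * real (fst i) + (\<Sum>j\<in>J. z j * real (snd i j)) - s\<bar> powr p\<bar>"
      unfolding M_def t_def I_def by blast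
  qed
qed

subsection \<open>Counting memory states\<close>

lemma sum_Pow_power_card:
  fixes x :: real
  assumes "finite I"
  shows "(\<Sum>X\<in>Pow I. x ^ card X) = (1 + x) ^ card I"
  using prod_add[OF assms, of "\<lambda>_. x" "\<lambda>_. 1"] by (simp add: add.commute)

lemma card_small_subsets_le:
  assumes I: "finite I"
  shows "real (card {X \<in> Pow I. 16 * card X < card I}) \<le> 2 powr (card I / 2)"
proof -
  \<comment> \<open>Chernoff: weight a set \<open>X\<close> by \<open>(1 / 8) ^ card X\<close>.\<close>
  let ?N = "real (card I)"
  let ?B = "{X \<in> Pow I. 16 * card X < card I}"
  have "(1 / 8 :: real) = 2 powr - 3" by (simp add: powr_minus)
  then have eighth: "(1 / 8) ^ c = (2::real) powr (- 3 * real c)" for c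
    by (simp only: powr_power) (simp add: mult.commute)
  have "real (card ?B) * 2 powr (- 3 * ?N / 16) = (\<Sum>X\<in>?B. 2 powr (- 3 * ?N / 16))" by simp
  also have "\<dots> \<le> (\<Sum>X\<in>?B. (1 / 8) ^ card X)"
    unfolding eighth by (intro sum_mono powr_mono) auto
  also have "\<dots> \<le> (\<Sum>X\<in>Pow I. (1 / 8) ^ card X)"
    using I by (intro sum_mono2) auto
  also have "\<dots> = (9 / 8) ^ card I" by (simp add: sum_Pow_power_card I)
  \<comment> \<open>The exponent is \<open>1 / 2 - 3 / 16\<close>, and the inequality reduces to
    \<open>(9 / 8) ^ 16 \<le> 2 ^ 5\<close>.\<close>
  also have "\<dots> \<le> (2 powr (5 / 16)) ^ card I"
  proof (intro power_mono)
    have "(2 powr (5 / 16)) ^ Suc 15 = (2 :: real) powr 5" by (subst powr_power) auto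
    then have "(9 / 8 :: real) ^ Suc 15 \<le> (2 powr (5 / 16)) ^ Suc 15"
      by (simp only:) (simp add: power_divide)
    then show "(9 / 8 :: real) \<le> 2 powr (5 / 16)" by (rule power_le_imp_le_base) simp
  qed simp
  also have "\<dots> = 2 powr (?N / 2) * 2 powr (- 3 * ?N / 16)"
    by (simp add: powr_power mult.commute flip: powr_add)
  finally show ?thesis by simp
qed

text \<open>The expected number of events that occur is the sum of their probabilities; if the
  number were almost surely below \<open>q * card S\<close>, so would be its expectation. This fixes
  the random coins.\<close>

lemma (in prob_space) exists_outcome_in_many_events:
  assumes S: "finite S" and E: "\<And>s. s \<in> S \<Longrightarrow> E s \<in> events" "\<And>s. s \<in> S \<Longrightarrow> q \<le> prob (E s)"
    and P: "AE x in M. P x"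
  shows "\<exists>x. P x \<and> q * card S \<le> card {s \<in> S. x \<in> E s}"
proof (rule ccontr)
  assume neg: "\<not> ?thesis"
  define f :: "'a \<Rightarrow> real" where "f = (\<lambda>x. \<Sum>s\<in>S. indicator (E s) x)"
  have f: "f x = card {s \<in> S. x \<in> E s}" for x
    using S unfolding f_def by (simp add: indicator_def sum.If_cases Int_def)
  have "AE x in M. f x < q * card S"
    using P by eventually_elim (use neg f in \<open>force simp: not_le\<close>)
  moreover have ind: "integrable M (indicat_real (E s))" if "s \<in> S" for s
    using E(1)[OF that] by (intro integrable_real_indicator) (auto simp: emeasure_eq_measure)
  moreover have int: "integrable M f"
    unfolding f_def by (intro Bochner_Integration.integrable_sum ind)
  ultimately have "expectation f < q * card S" by (intro expectation_less)
  moreover have "expectation f = (\<Sum>s\<in>S. prob (E s))"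
    unfolding f_def using E by (subst Bochner_Integration.integral_sum[OF ind]) auto
  moreover have "q * card S \<le> (\<Sum>s\<in>S. prob (E s))"
    using sum_mono[OF E(2), of S] by (simp add: mult.commute)
  ultimately show False by simp
qed

section \<open>Bit strings and the number of inputs they can serve\<close>

lemma card_bool_lists_length_le: "card {w :: bool list. length w \<le> s} \<le> 2 ^ (s + 1)"
proof -
  have "card {w :: bool list. length w \<le> s} = (\<Sum>i\<le>s. 2 ^ i)"
    using card_lists_length_le[of "UNIV :: bool set" s] by simp
  also have "\<dots> \<le> 2 ^ (s + 1)" by (induction s) auto
  finally show ?thesis .
qed

text \<open>Infima of nonempty sets of extended naturals are attained, so \<open>bits_used\<close>
  is itself an almost sure bound.\<close>

lemma bits_used_le_iff:
  "bits_used D A \<le> enat s \<longleftrightarrow> (AE Q in D. length (store Q A) \<le> s)"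
proof
  define X where "X = {t. AE Q in D. enat (length (store Q A)) \<le> t}"
  assume le: "bits_used D A \<le> enat s"
  then have "X \<noteq> {}" unfolding bits_used_def X_def[symmetric] by (auto simp: Inf_enat_def)
  then have "bits_used D A \<in> X"
    unfolding bits_used_def X_def[symmetric] Inf_enat_def by (auto intro: LeastI)
  then have "AE Q in D. enat (length (store Q A)) \<le> bits_used D A" by (simp add: X_def)
  then show "AE Q in D. length (store Q A) \<le> s"
    by eventually_elim (use le order_trans in fastforce)
next
  assume "AE Q in D. length (store Q A) \<le> s"
  then show "bits_used D A \<le> enat s" unfolding bits_used_def by (intro Inf_lower) simp
qed

text \<open>Symmetric difference with a fixed member maps each fibre of \<open>g\<close> injectively
  into a Hamming ball around the empty set; the fibres are indexed by strings of length at most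
  \<open>s\<close>.\<close>

lemma card_le_of_encoding:
  fixes g :: "'i set \<Rightarrow> bool list"
  assumes I: "finite I" and F: "F \<subseteq> Pow I"
    and len: "\<And>X. X \<in> F \<Longrightarrow> length (g X) \<le> s"
    and close: "\<And>X Y. X \<in> F \<Longrightarrow> Y \<in> F \<Longrightarrow> g X = g Y \<Longrightarrow> 16 * card (sym_diff X Y) < card I"
  shows "real (card F) \<le> 2 ^ (s + 1) * 2 powr (card I / 2)"
proof -
  have finF: "finite F" using F I finite_subset by blast
  have fibre: "real (card {X \<in> F. g X = w}) \<le> 2 powr (card I / 2)" if "w \<in> g ` F" for w
  proof -
    from that obtain Y where Y: "Y \<in> F" "w = g Y" by blast
    have "inj_on (\<lambda>X. sym_diff X Y) {X \<in> F. g X = w}"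
      by (rule inj_onI) blast
    moreover have "(\<lambda>X. sym_diff X Y) ` {X \<in> F. g X = w} \<subseteq> {X \<in> Pow I. 16 * card X < card I}"
      using Y F close by auto
    ultimately have "card {X \<in> F. g X = w} \<le> card {X \<in> Pow I. 16 * card X < card I}"
      using I by (intro card_inj_on_le) auto
    then show ?thesis using card_small_subsets_le[OF I] by linarith
  qed
  have "F = (\<Union>w\<in>g ` F. {X \<in> F. g X = w})" by blast
  then have "card F \<le> (\<Sum>w\<in>g ` F. card {X \<in> F. g X = w})"
    using card_UN_le[of "g ` F" "\<lambda>w. {X \<in> F. g X = w}"] finF by simp
  then have "real (card F) \<le> (\<Sum>w\<in>g ` F. real (card {X \<in> F. g X = w}))"
    by (simp only: of_nat_le_iff flip: of_nat_sum)
  also have "\<dots> \<le> (\<Sum>w\<in>g ` F. 2 powr (card I / 2))" by (intro sum_mono fibre)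
  also have "\<dots> = real (card (g ` F)) * 2 powr (card I / 2)" by simp
  also have "\<dots> \<le> 2 ^ (s + 1) * 2 powr (card I / 2)"
  proof (intro mult_right_mono)
    have "finite {w :: bool list. length w \<le> s}"
      using finite_lists_length_le[of "UNIV :: bool set" s] by simp
    then have "card (g ` F) \<le> card {w :: bool list. length w \<le> s}"
      using len by (intro card_mono) auto
    also have "\<dots> \<le> 2 ^ (s + 1)" by (rule card_bool_lists_length_le)
    finally show "real (card (g ` F)) \<le> 2 ^ (s + 1)"
      by (metis of_nat_le_iff of_nat_numeral of_nat_power)
  qed simp
  finally show ?thesis .
qed

text \<open>For suitable fixed coins at least \<open>q * 2 ^ card I\<close> subsets are served
  correctly. Two of them with the same stored string get the same answer at every \<open>x\<close>,
  so the triangle inequality and \<open>sep\<close> keep them close.\<close>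

lemma solves_subspace_sketch_space_lower_bound:
  fixes D :: "'d::finite sketch measure" and R :: "'i set \<Rightarrow> 'd rows"
  assumes D: "solves_subspace_sketch C q n p \<epsilon> D" and I: "finite I"
    and R: "\<And>X. X \<subseteq> I \<Longrightarrow> R X \<in> input_matrices C n"
    and bits: "\<And>X. X \<subseteq> I \<Longrightarrow> bits_used D (R X) \<le> enat s"
    and sep: "\<And>X Y. X \<subseteq> I \<Longrightarrow> Y \<subseteq> I \<Longrightarrow> card I \<le> 16 * card (sym_diff X Y) \<Longrightarrow>
      \<exists>x. \<epsilon> * (lp_form p (R X) x + lp_form p (R Y) x) < \<bar>lp_form p (R X) x - lp_form p (R Y) x\<bar>"
  shows "q * 2 ^ card I \<le> 2 ^ (s + 1) * 2 powr (card I / 2)"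
proof -
  interpret prob_space D using D by (simp add: solves_subspace_sketch_def)
  have "\<forall>X\<in>Pow I. \<exists>E\<in>sets D. q \<le> measure D E \<and>
      (\<forall>Q\<in>E. \<forall>x. \<bar>answer Q (store Q (R X)) x - lp_form p (R X) x\<bar> \<le> \<epsilon> * lp_form p (R X) x)"
    using D R by (auto simp: solves_subspace_sketch_def)
  then obtain E where E: "\<And>X. X \<in> Pow I \<Longrightarrow> E X \<in> events" "\<And>X. X \<in> Pow I \<Longrightarrow> q \<le> prob (E X)"
    "\<And>X Q x. X \<in> Pow I \<Longrightarrow> Q \<in> E X \<Longrightarrow>
      \<bar>answer Q (store Q (R X)) x - lp_form p (R X) x\<bar> \<le> \<epsilon> * lp_form p (R X) x"
    by metis
  have finP: "finite (Pow I)" using I by simp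
  \<comment> \<open>Only finitely many inputs occur, so their almost sure length bounds hold
    simultaneously.\<close>
  have "AE Q in D. \<forall>X\<in>Pow I. length (store Q (R X)) \<le> s"
    using bits finP by (intro AE_finite_allI) (auto simp: bits_used_le_iff)
  then have "\<exists>Q. (\<forall>X\<in>Pow I. length (store Q (R X)) \<le> s) \<and>
      q * card (Pow I) \<le> card {X \<in> Pow I. Q \<in> E X}"
    by (intro exists_outcome_in_many_events finP E)
  then obtain Q where Q: "\<forall>X\<in>Pow I. length (store Q (R X)) \<le> s"
    "q * card (Pow I) \<le> card {X \<in> Pow I. Q \<in> E X}"
    by (elim exE conjE)
  have "real (card {X \<in> Pow I. Q \<in> E X}) \<le> 2 ^ (s + 1) * 2 powr (card I / 2)"
  proof (rule card_le_of_encoding[OF I, where g = "\<lambda>X. store Q (R X)"])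
    fix X Y assume XY: "X \<in> {X \<in> Pow I. Q \<in> E X}" "Y \<in> {X \<in> Pow I. Q \<in> E X}"
      and eq: "store Q (R X) = store Q (R Y)"
    show "16 * card (sym_diff X Y) < card I"
    proof (rule ccontr)
      assume "\<not> ?thesis"
      then obtain x where
        "\<epsilon> * (lp_form p (R X) x + lp_form p (R Y) x) < \<bar>lp_form p (R X) x - lp_form p (R Y) x\<bar>"
        using sep[of X Y] XY by auto
      moreover have "\<bar>answer Q (store Q (R X)) x - lp_form p (R X) x\<bar> \<le> \<epsilon> * lp_form p (R X) x"
        "\<bar>answer Q (store Q (R X)) x - lp_form p (R Y) x\<bar> \<le> \<epsilon> * lp_form p (R Y) x"
        using E(3)[of X Q x] E(3)[of Y Q x] XY eq by auto
      ultimately show False by (simp add: distrib_left)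
    qed
  qed (use Q in auto)
  then show ?thesis using Q(2) I by (simp add: card_Pow)
qed

subsection \<open>The lower bound\<close>

text \<open>Coordinate \<open>j\<^sub>0\<close> of a row is the constant 1, which pairs with the
  shift \<open>- s\<close> of the query; \<open>j\<^sub>1\<close> carries the first grid coordinate
  and \<open>J\<close> the others. The constant 1 is the reason for \<open>k > 0\<close> in the
  entry bound.\<close>

lemma exists_grid_rows:
  fixes p :: real
  assumes d: "CARD('d::finite) \<ge> 2" and p: "p > 0" "\<not> (\<exists>k::int. p = 2 * of_int k)"
  shows "\<exists>c::real>0. \<exists>C::real>0. \<exists>k\<^sub>0. \<exists>(u :: nat \<times> ('d \<Rightarrow> nat) \<Rightarrow> real ^ 'd) I.
    (\<forall>k. finite (I k) \<and> card (I k) = k ^ (CARD('d) - 1)) \<and>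
    (\<forall>k>0. \<forall>i\<in>I k. \<forall>j. u i $ j \<in> \<int> \<and> \<bar>u i $ j\<bar> \<le> real k) \<and>
    (\<forall>k\<ge>k\<^sub>0. \<forall>a. (\<forall>i. \<bar>a i\<bar> \<le> 1) \<longrightarrow>
      real (k ^ (CARD('d) - 1)) / 16 \<le> (\<Sum>i\<in>I k. (a i)\<^sup>2) \<longrightarrow>
      (\<exists>x. (\<forall>i\<in>I k. \<bar>u i \<bullet> x\<bar> \<le> C * real k) \<and>
        c * sqrt (real k ^ (CARD('d) - 2)) \<le> \<bar>\<Sum>i\<in>I k. a i * \<bar>u i \<bullet> x\<bar> powr p\<bar>))"
proof -
  obtain j\<^sub>0 j\<^sub>1 :: 'd where j: "j\<^sub>0 \<noteq> j\<^sub>1"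
    using d card_le_Suc0_iff_eq[of "UNIV :: 'd set"] by force
  define J where "J = UNIV - {j\<^sub>0, j\<^sub>1}"
  have J: "finite J" by simp
  have cardJ: "card J = CARD('d) - 2" using j by (simp add: J_def card_Diff_subset)
  then have SJ: "Suc (card J) = CARD('d) - 1" using d by simp
  obtain c C :: real and k\<^sub>0 where c: "c > 0" "C > 0" and key:
    "\<forall>k\<ge>k\<^sub>0. \<forall>a :: nat \<times> ('d \<Rightarrow> nat) \<Rightarrow> real. (\<forall>i. \<bar>a i\<bar> \<le> 1) \<longrightarrow>
    real (k ^ Suc (card J)) / 16 \<le> (\<Sum>i\<in>{..<k} \<times> (J \<rightarrow>\<^sub>E {..<k}). (a i)\<^sup>2) \<longrightarrow>
    (\<exists>y z s. (\<forall>i\<in>{..<k} \<times> (J \<rightarrow>\<^sub>E {..<k}). \<bar>y * real (fst i) + (\<Sum>j\<in>J. z j * real (snd i j)) - s\<bar> \<le> C * real k) \<and>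
      c * sqrt (real k ^ card J) \<le> \<bar>\<Sum>i\<in>{..<k} \<times> (J \<rightarrow>\<^sub>E {..<k}).
        a i * \<bar>y * real (fst i) + (\<Sum>j\<in>J. z j * real (snd i j)) - s\<bar> powr p\<bar>)"
    using exists_direction_large_lp_sum[OF p J] by (elim exE conjE)
  define u :: "nat \<times> ('d \<Rightarrow> nat) \<Rightarrow> real ^ 'd" where
    "u = (\<lambda>i. \<chi> j. if j = j\<^sub>0 then 1 else if j = j\<^sub>1 then real (fst i) else real (snd i j))"
  define I where "I = (\<lambda>k. {..<k} \<times> (J \<rightarrow>\<^sub>E {..<k::nat}))"
  define X :: "real \<Rightarrow> ('d \<Rightarrow> real) \<Rightarrow> real \<Rightarrow> real ^ 'd" where
    "X = (\<lambda>y z s. \<chi> j. if j = j\<^sub>0 then - s else if j = j\<^sub>1 then y else z j)"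
  have inner: "u i \<bullet> X y z s = y * real (fst i) + (\<Sum>j\<in>J. z j * real (snd i j)) - s" for i y z s
  proof -
    have UN: "(UNIV :: 'd set) = insert j\<^sub>0 (insert j\<^sub>1 J)" by (auto simp: J_def)
    have nin: "j\<^sub>0 \<notin> insert j\<^sub>1 J" "j\<^sub>1 \<notin> J" using j by (auto simp: J_def)
    have "u i \<bullet> X y z s = (\<Sum>j\<in>UNIV. u i $ j * X y z s $ j)" by (simp add: inner_vec_def)
    also have "\<dots> = - s + (real (fst i) * y + (\<Sum>j\<in>J. u i $ j * X y z s $ j))"
      unfolding UN using nin j J by (simp add: u_def X_def)
    also have "(\<Sum>j\<in>J. u i $ j * X y z s $ j) = (\<Sum>j\<in>J. z j * real (snd i j))"
      by (intro sum.cong) (auto simp: u_def X_def J_def)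
    finally show ?thesis by simp
  qed
  show ?thesis
  proof (rule exI[of _ c], rule conjI[rotated], rule exI[of _ C], rule conjI[rotated], rule exI[of _ k\<^sub>0],
      rule exI[of _ u], rule exI[of _ I], intro conjI allI ballI impI)
    fix k show "finite (I k)" unfolding I_def using J by (intro finite_cartesian_product finite_PiE) auto
    show "card (I k) = k ^ (CARD('d) - 1)"
      unfolding SJ[symmetric] using J by (simp add: I_def card_cartesian_product card_PiE)
  next
    fix k :: nat and i j assume "k > 0" "i \<in> I k"
    moreover have "snd i j < k" if "j \<noteq> j\<^sub>0" "j \<noteq> j\<^sub>1"
    proof -
      have "j \<in> J" using that by (simp add: J_def)
      then show ?thesis using \<open>i \<in> I k\<close> by (auto simp: I_def PiE_iff)
    qed
    ultimately show "\<bar>u i $ j\<bar> \<le> real k"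
      by (auto simp: u_def I_def less_imp_le)
    show "u i $ j \<in> \<int>" by (simp add: u_def)
  next
    fix k and a :: "nat \<times> ('d \<Rightarrow> nat) \<Rightarrow> real"
    assume k: "k \<ge> k\<^sub>0" and a: "\<forall>i. \<bar>a i\<bar> \<le> 1"
      "real (k ^ (CARD('d) - 1)) / 16 \<le> (\<Sum>i\<in>I k. (a i)\<^sup>2)"
    have "\<exists>y z s. (\<forall>i\<in>I k. \<bar>u i \<bullet> X y z s\<bar> \<le> C * real k) \<and>
        c * sqrt (real k ^ card J) \<le> \<bar>\<Sum>i\<in>I k. a i * \<bar>u i \<bullet> X y z s\<bar> powr p\<bar>"
      unfolding inner I_def
      by (rule key[rule_format, OF k]) (use a in \<open>simp_all only: SJ I_def\<close>)
    then obtain y z s where "\<forall>i\<in>I k. \<bar>u i \<bullet> X y z s\<bar> \<le> C * real k"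
      "c * sqrt (real k ^ card J) \<le> \<bar>\<Sum>i\<in>I k. a i * \<bar>u i \<bullet> X y z s\<bar> powr p\<bar>"
      by (elim exE conjE)
    then show "\<exists>x. (\<forall>i\<in>I k. \<bar>u i \<bullet> x\<bar> \<le> C * real k) \<and>
        c * sqrt (real k ^ (CARD('d) - 2)) \<le> \<bar>\<Sum>i\<in>I k. a i * \<bar>u i \<bullet> x\<bar> powr p\<bar>"
      unfolding cardJ by (intro exI[of _ "X y z s"] conjI)
  qed (use c in auto)
qed

text \<open>All inputs must have the same number \<open>n\<close> of rows, so absent rows become
  zero rows, which contribute \<open>0 powr p = 0\<close>.\<close>

lemma lp_form_subfamily:
  assumes e: "bij_betw e {..<N} I" and n: "N \<le> n" and X: "X \<subseteq> I"
  shows "lp_form p (map (\<lambda>l. if l < N \<and> e l \<in> X then u (e l) else 0) [0..<n]) x = (\<Sum>i\<in>X. \<bar>u i \<bullet> x\<bar> powr p)"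
proof -
  have "lp_form p (map (\<lambda>l. if l < N \<and> e l \<in> X then u (e l) else 0) [0..<n]) x
      = (\<Sum>l<n. if l < N \<and> e l \<in> X then \<bar>u (e l) \<bullet> x\<bar> powr p else 0)"
    unfolding lp_form_def by (intro sum.cong) auto
  also have "\<dots> = (\<Sum>l\<in>{l. l < N \<and> e l \<in> X}. \<bar>u (e l) \<bullet> x\<bar> powr p)"
    using n by (subst sum.inter_filter[symmetric]) (auto intro!: sum.cong)
  also have "\<dots> = (\<Sum>i\<in>X. \<bar>u i \<bullet> x\<bar> powr p)"
  proof (rule sum.reindex_bij_betw[where h = e and g = "\<lambda>i. \<bar>u i \<bullet> x\<bar> powr p"])
    have "e ` {l. l < N \<and> e l \<in> X} = X"
      using e X by (force simp: bij_betw_def)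
    then show "bij_betw e {l. l < N \<and> e l \<in> X} X"
      using bij_betw_subset[OF e, of "{l. l < N \<and> e l \<in> X}" X] by auto
  qed
  finally show ?thesis .
qed

text \<open>Apply \<open>key\<close> to the difference of the two indicators: its energy is the size
  of the symmetric difference. Each of the two sums is at most \<open>card I * b\<close>, which
  bounds the tolerance.\<close>

lemma lp_sums_separated:
  fixes w :: "'x \<Rightarrow> 'i \<Rightarrow> real" and X Y I :: "'i set" and b \<mu> \<epsilon> :: real
  assumes I: "finite I" and XY: "X \<subseteq> I" "Y \<subseteq> I" "card I \<le> 16 * card (sym_diff X Y)"
    and key: "\<And>a :: 'i \<Rightarrow> real. \<lbrakk>\<And>i. \<bar>a i\<bar> \<le> 1; real (card I) / 16 \<le> (\<Sum>i\<in>I. (a i)\<^sup>2)\<rbrakk> \<Longrightarrow>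
      \<exists>x. (\<forall>i\<in>I. 0 \<le> w x i \<and> w x i \<le> b) \<and> \<mu> \<le> \<bar>\<Sum>i\<in>I. a i * w x i\<bar>"
    and b: "2 * \<epsilon> * card I * b < \<mu>" and \<epsilon>: "\<epsilon> > 0"
  shows "\<exists>x. \<epsilon> * (sum (w x) X + sum (w x) Y) < \<bar>sum (w x) X - sum (w x) Y\<bar>"
proof -
  define a :: "'i \<Rightarrow> real" where "a = (\<lambda>i. indicator X i - indicator Y i)"
  have fin: "finite X" "finite Y" using I XY finite_subset by blast+
  have "(\<Sum>i\<in>I. (a i)\<^sup>2) = (\<Sum>i\<in>I. if i \<in> sym_diff X Y then 1 else 0)"
    by (intro sum.cong) (auto simp: a_def indicator_def)
  also have "\<dots> = card (I \<inter> sym_diff X Y)" using I by (subst sum.If_cases) (auto intro!: arg_cong[where f = card])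
  also have "I \<inter> sym_diff X Y = sym_diff X Y" using XY by blast
  finally have "(\<Sum>i\<in>I. (a i)\<^sup>2) = card (sym_diff X Y)" .
  moreover have "real (card I) \<le> 16 * real (card (sym_diff X Y))" using XY(3) by linarith
  moreover have "\<bar>a i\<bar> \<le> 1" for i by (simp add: a_def indicator_def)
  ultimately obtain x where x: "\<forall>i\<in>I. 0 \<le> w x i \<and> w x i \<le> b" "\<mu> \<le> \<bar>\<Sum>i\<in>I. a i * w x i\<bar>"
    using key[of a] by auto
  have ind: "(\<Sum>i\<in>I. indicator Z i * w x i) = sum (w x) Z" if "Z \<subseteq> I" for Z
    using I that by (simp add: indicator_def if_distrib[of "\<lambda>c. c * _"] sum.If_cases Int_absorb1 cong: if_cong)
  have bound: "sum (w x) Z \<le> card I * b" if "Z \<subseteq> I" for Z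
  proof -
    have "sum (w x) Z \<le> sum (w x) I" using I that x by (intro sum_mono2) auto
    also have "\<dots> \<le> card I * b" using sum_mono[of I "w x" "\<lambda>_. b"] x by simp
    finally show ?thesis .
  qed
  have "\<epsilon> * (sum (w x) X + sum (w x) Y) \<le> \<epsilon> * (card I * b + card I * b)"
    using bound XY \<epsilon> by (intro mult_left_mono add_mono) auto
  also have "\<dots> < \<mu>" using b by (simp add: algebra_simps)
  also have "\<dots> \<le> \<bar>sum (w x) X - sum (w x) Y\<bar>"
    using x(2) XY by (simp add: a_def left_diff_distrib sum_subtractf ind)
  finally show ?thesis by blast
qed

text \<open>Take the integer part of \<open>(\<theta> / \<epsilon>) powr e\<close>. Of the upper
  bounds on \<open>k\<close>, the first lets the grid fit into the admissible matrices and the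
  second lets the separation beat the tolerance; the final lower bound yields the number of
  bits.\<close>

lemma exists_grid_size:
  fixes e \<theta> :: real
  assumes e: "e > 0" and \<theta>: "\<theta> > 0"
  obtains \<epsilon>\<^sub>0 :: real where "0 < \<epsilon>\<^sub>0" "\<epsilon>\<^sub>0 \<le> 1"
    "\<And>\<epsilon>. 0 < \<epsilon> \<Longrightarrow> \<epsilon> < \<epsilon>\<^sub>0 \<Longrightarrow> \<exists>k::nat. k\<^sub>1 \<le> k \<and> real k \<le> \<epsilon> powr (- (e + 1)) \<and>
      real k powr (1 / e) * \<epsilon> \<le> \<theta> \<and> (\<theta> / \<epsilon>) powr e \<le> 2 * real k"
proof -
  \<comment> \<open>The second term gives \<open>\<theta> powr e \<le> 1 / \<epsilon>\<close>, hence
    the polynomial bound on \<open>k\<close>; the third makes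
    \<open>(\<theta> / \<epsilon>) powr e\<close> at least \<open>k\<^sub>1 + 1\<close>.\<close>
  define \<epsilon>\<^sub>0 where "\<epsilon>\<^sub>0 = min 1 (min (\<theta> powr (- e)) (\<theta> * (real k\<^sub>1 + 1) powr (- (1 / e))))"
  show ?thesis
  proof (rule that[of \<epsilon>\<^sub>0])
    show "0 < \<epsilon>\<^sub>0" "\<epsilon>\<^sub>0 \<le> 1" using \<theta> by (auto simp: \<epsilon>\<^sub>0_def)
  next
    fix \<epsilon> :: real assume \<epsilon>: "0 < \<epsilon>" "\<epsilon> < \<epsilon>\<^sub>0"
    define t where "t = (\<theta> / \<epsilon>) powr e"
    define k where "k = nat \<lfloor>t\<rfloor>"
    have \<epsilon>1: "\<epsilon> \<le> 1" "\<epsilon> \<le> \<theta> powr (- e)" "\<epsilon> \<le> \<theta> * (real k\<^sub>1 + 1) powr (- (1 / e))"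
      using \<epsilon> by (auto simp: \<epsilon>\<^sub>0_def)
    have "(real k\<^sub>1 + 1) powr (1 / e) * \<epsilon> \<le> (real k\<^sub>1 + 1) powr (1 / e) * (\<theta> * (real k\<^sub>1 + 1) powr (- (1 / e)))"
      by (intro mult_left_mono \<epsilon>1) simp
    also have "\<dots> = \<theta> * ((real k\<^sub>1 + 1) powr (1 / e) * (real k\<^sub>1 + 1) powr (- (1 / e)))"
      by (simp only: mult_ac)
    also have "\<dots> = \<theta>" by (simp flip: powr_add)
    finally have "(real k\<^sub>1 + 1) powr (1 / e) \<le> \<theta> / \<epsilon>" using \<epsilon> by (simp add: field_simps)
    then have "((real k\<^sub>1 + 1) powr (1 / e)) powr e \<le> t"
      unfolding t_def using e by (intro powr_mono2) auto
    then have t: "real k\<^sub>1 + 1 \<le> t" using e by (simp add: powr_powr)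
    have k: "real k \<le> t" "t < real k + 1" using t unfolding k_def by linarith+
    have "1 \<le> k" unfolding k_def using t by (intro le_nat_floor) simp
    show "\<exists>k::nat. k\<^sub>1 \<le> k \<and> real k \<le> \<epsilon> powr (- (e + 1)) \<and>
      real k powr (1 / e) * \<epsilon> \<le> \<theta> \<and> (\<theta> / \<epsilon>) powr e \<le> 2 * real k"
    proof (intro exI[of _ k] conjI)
      show "k\<^sub>1 \<le> k" using t k by linarith
      show "(\<theta> / \<epsilon>) powr e \<le> 2 * real k" using \<open>1 \<le> k\<close> k by (fold t_def) linarith
      have "t = \<theta> powr e * \<epsilon> powr (- e)"
        using \<epsilon> \<theta> by (simp add: t_def powr_divide powr_minus_divide)
      also have "\<dots> \<le> \<epsilon> powr (- 1) * \<epsilon> powr (- e)"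
      proof (intro mult_right_mono)
        have "\<theta> powr e * \<epsilon> \<le> \<theta> powr e * \<theta> powr (- e)" by (intro mult_left_mono \<epsilon>1) simp
        also have "\<dots> = 1" using \<theta> by (simp flip: powr_add)
        finally show "\<theta> powr e \<le> \<epsilon> powr (- 1)" using \<epsilon> by (simp add: powr_minus field_simps)
      qed simp
      also have "\<dots> = \<epsilon> powr (- (e + 1))" by (simp only: powr_add[symmetric]) (simp add: algebra_simps)
      finally show "real k \<le> \<epsilon> powr (- (e + 1))" using k by simp
      have "real k powr (1 / e) \<le> t powr (1 / e)" using e k by (intro powr_mono2) auto
      also have "\<dots> = \<theta> / \<epsilon>" using e \<epsilon> \<theta> by (simp add: t_def powr_powr)
      finally show "real k powr (1 / e) * \<epsilon> \<le> \<theta>" using \<epsilon> by (simp add: field_simps)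
    qed
  qed
qed

text \<open>The lower bound on \<open>n\<close> leaves room for all grid rows and, through the entry
  bound, for entries up to \<open>k\<close>. The constant \<open>c\<close> precedes \<open>q\<close>
  and \<open>C\<close>, which affect only \<open>K\<close> and
  \<open>\<epsilon>\<^sub>0\<close>.\<close>

theorem theorem3p4:
  fixes p :: real
  assumes d: "CARD('d::finite) \<ge> 2"
    and p: "1 \<le> p" "\<not> (\<exists>k::int. p = 2 * of_int k)"
  shows "\<exists>c::real>0. \<forall>q::real>0. \<forall>C::real>0. \<exists>K::real>0. \<exists>\<epsilon>\<^sub>0::real>0. \<forall>\<epsilon>::real.
    0 < \<epsilon> \<and> \<epsilon> < \<epsilon>\<^sub>0 \<longrightarrow>
    (\<forall>n::nat. real n \<ge> \<epsilon> powr (- K) \<longrightarrow>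
      (\<forall>D :: 'd sketch measure. solves_subspace_sketch C q n p \<epsilon> D \<longrightarrow>
        (\<exists>A \<in> input_matrices C n.
           ereal (c * \<epsilon> powr (- (2 * (real CARD('d) - 1) / (real CARD('d) + 2 * p))))
             \<le> ereal_of_enat (bits_used D A))))"
proof -
  define m where "m = CARD('d) - 1"
  have m: "m \<ge> 1" "real CARD('d) = real m + 1" "CARD('d) - 2 = m - 1"
    using d by (auto simp: m_def)
  define e where "e = 2 / (real CARD('d) + 2 * p)"
  have e: "e > 0" using p by (simp add: e_def add_pos_pos)
  \<comment> \<open>The balance of the argument: the tolerance
    \<open>\<epsilon> * k ^ m * k powr p\<close> and the separation
    \<open>k powr ((m - 1) / 2)\<close> have ratio
    \<open>\<epsilon> * k powr (1 / e)\<close>.\<close>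
  have e': "1 / e = p + (real m + 1) / 2" by (simp add: e_def m(2) field_simps)
  have expo: "2 * (real CARD('d) - 1) / (real CARD('d) + 2 * p) = e * real m"
    by (simp add: e_def m(2))
  have "p > 0" using p by simp
  from exists_grid_rows[OF d this p(2)] obtain c\<^sub>1 C\<^sub>1 :: real and k\<^sub>0
    and u :: "nat \<times> ('d \<Rightarrow> nat) \<Rightarrow> real ^ 'd" and I where c\<^sub>1: "c\<^sub>1 > 0" and C\<^sub>1: "C\<^sub>1 > 0"
    and I: "\<forall>k. finite (I k) \<and> card (I k) = k ^ m"
    and u: "\<forall>k>0. \<forall>i\<in>I k. \<forall>j. u i $ j \<in> \<int> \<and> \<bar>u i $ j\<bar> \<le> real k"
    and key: "\<forall>k\<ge>k\<^sub>0. \<forall>a. (\<forall>i. \<bar>a i\<bar> \<le> 1) \<longrightarrow>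
      real (k ^ m) / 16 \<le> (\<Sum>i\<in>I k. (a i)\<^sup>2) \<longrightarrow>
      (\<exists>x. (\<forall>i\<in>I k. \<bar>u i \<bullet> x\<bar> \<le> C\<^sub>1 * real k) \<and>
        c\<^sub>1 * sqrt (real k ^ (CARD('d) - 2)) \<le> \<bar>\<Sum>i\<in>I k. a i * \<bar>u i \<bullet> x\<bar> powr p\<bar>)"
    unfolding m_def[symmetric] by (elim exE conjE)
  \<comment> \<open>The 4 absorbs the 2 in front of the tolerance and leaves half of the separation
    for a strict inequality.\<close>
  define \<theta> where "\<theta> = c\<^sub>1 / (4 * C\<^sub>1 powr p)"
  have \<theta>: "\<theta> > 0" using c\<^sub>1 C\<^sub>1 by (simp add: \<theta>_def)
  \<comment> \<open>Rounding gives \<open>k\<close> at least half of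
    \<open>(\<theta> / \<epsilon>) powr e\<close>; the target is a quarter of
    \<open>k ^ m\<close>.\<close>
  define c where "c = (\<theta> powr e / 2) ^ m / 4"
  show ?thesis
  proof (rule exI[of _ c], intro conjI allI impI)
    show "c > 0" using \<theta> by (simp add: c_def)
  next
    fix q C :: real assume q: "q > 0" and C: "C > 0"
    \<comment> \<open>The last term makes \<open>N / 4\<close> exceed \<open>log 2 (2 / q)\<close>,
      which gives the final contradiction.\<close>
    define k\<^sub>1 where "k\<^sub>1 = max (max 1 k\<^sub>0) (Suc (nat \<lceil>4 * log 2 (2 / q)\<rceil>))"
    \<comment> \<open>The summand with \<open>m\<close> ensures \<open>k ^ m \<le> n\<close>, the
      one with \<open>1 / C\<close> that entries of size \<open>k\<close> are admissible.\<close>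
    define K where "K = (e + 1) * (real m + 1 / C)"
    have K: "K > 0" using e C m by (simp add: K_def add_pos_pos)
    have K1: "(e + 1) * real m \<le> K" "e + 1 \<le> K * C"
      using e C by (auto simp: K_def field_simps)
    obtain \<epsilon>\<^sub>0 where \<epsilon>\<^sub>0: "0 < \<epsilon>\<^sub>0" "\<epsilon>\<^sub>0 \<le> 1" and grid:
      "\<And>\<epsilon>. 0 < \<epsilon> \<Longrightarrow> \<epsilon> < \<epsilon>\<^sub>0 \<Longrightarrow> \<exists>k::nat. k\<^sub>1 \<le> k \<and> real k \<le> \<epsilon> powr (- (e + 1)) \<and>
      real k powr (1 / e) * \<epsilon> \<le> \<theta> \<and> (\<theta> / \<epsilon>) powr e \<le> 2 * real k"
      by (rule exists_grid_size[OF e \<theta>]) (rule that)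
    show "\<exists>K>0. \<exists>\<epsilon>\<^sub>0>0. \<forall>\<epsilon>. 0 < \<epsilon> \<and> \<epsilon> < \<epsilon>\<^sub>0 \<longrightarrow>
      (\<forall>n::nat. real n \<ge> \<epsilon> powr (- K) \<longrightarrow>
        (\<forall>D :: 'd sketch measure. solves_subspace_sketch C q n p \<epsilon> D \<longrightarrow>
          (\<exists>A \<in> input_matrices C n.
             ereal (c * \<epsilon> powr (- (2 * (real CARD('d) - 1) / (real CARD('d) + 2 * p))))
               \<le> ereal_of_enat (bits_used D A))))"
    proof (rule exI[of _ K], rule conjI[OF K], rule exI[of _ \<epsilon>\<^sub>0], rule conjI[OF \<epsilon>\<^sub>0(1)],
        intro allI impI, elim conjE, rule ccontr)
      fix \<epsilon> n and D :: "'d sketch measure"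
      assume \<epsilon>: "0 < \<epsilon>" "\<epsilon> < \<epsilon>\<^sub>0" and n: "\<epsilon> powr (- K) \<le> real n"
        and D: "solves_subspace_sketch C q n p \<epsilon> D"
        and neg: "\<not> (\<exists>A \<in> input_matrices C n.
             ereal (c * \<epsilon> powr (- (2 * (real CARD('d) - 1) / (real CARD('d) + 2 * p))))
               \<le> ereal_of_enat (bits_used D A))"
      from grid[OF \<epsilon>] obtain k :: nat where k: "k\<^sub>1 \<le> k" "real k \<le> \<epsilon> powr (- (e + 1))"
        "real k powr (1 / e) * \<epsilon> \<le> \<theta>" "(\<theta> / \<epsilon>) powr e \<le> 2 * real k" by blast
      define N where "N = k ^ m"
      \<comment> \<open>Under the negated claim every grid input uses fewer than
        \<open>N / 4\<close> bits, hence, being an integer, at most \<open>s\<close>.\<close>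
      define s where "s = nat \<lfloor>real N / 4\<rfloor>"
      have k0: "k > 0" "k \<ge> k\<^sub>0" using k(1) by (auto simp: k\<^sub>1_def)
      have \<epsilon>1: "\<epsilon> \<le> 1" using \<epsilon> \<epsilon>\<^sub>0 by simp
      have finI: "finite (I k)" and cardI: "card (I k) = N" using I by (auto simp: N_def)
      have small: "c * \<epsilon> powr (- (e * real m)) \<le> real N / 4"
      proof -
        have "\<epsilon> powr (- (e * real m)) = (\<epsilon> powr (- e)) ^ m"
          using \<epsilon> by (subst powr_power) (auto simp: mult.commute)
        then have "c * \<epsilon> powr (- (e * real m)) = (\<theta> powr e * \<epsilon> powr (- e) / 2) ^ m / 4"
          by (simp only: c_def power_mult_distrib power_divide) simp
        also have "\<theta> powr e * \<epsilon> powr (- e) = (\<theta> / \<epsilon>) powr e"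
          using \<epsilon> \<theta> by (simp add: powr_divide powr_minus_divide)
        finally have "c * \<epsilon> powr (- (e * real m)) = ((\<theta> / \<epsilon>) powr e / 2) ^ m / 4" .
        also have "\<dots> \<le> real k ^ m / 4"
          using k(4) by (intro divide_right_mono power_mono) auto
        finally show ?thesis by (simp add: N_def)
      qed
      have Nn: "N \<le> n"
      proof -
        have "real N \<le> (\<epsilon> powr (- (e + 1))) ^ m" unfolding N_def of_nat_power
          using k(2) by (intro power_mono) auto
        also have "\<dots> = \<epsilon> powr (- ((e + 1) * real m))" using \<epsilon> by (simp add: powr_power algebra_simps)
        also have "\<dots> \<le> \<epsilon> powr (- K)" using K1 \<epsilon> \<epsilon>1 by (intro powr_mono') auto
        finally show ?thesis using n by linarith
      qed
      have kC: "real k \<le> 2 powr (C * log 2 (real n * real CARD('d)))"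
      proof -
        have "0 < \<epsilon> powr (- K)" using \<epsilon> by simp
        then have n0: "real n > 0" using n by linarith
        have "real k \<le> \<epsilon> powr (- (K * C))"
          by (rule order_trans[OF k(2)], rule powr_mono') (use K1 \<epsilon> \<epsilon>1 in auto)
        also have "\<dots> = (\<epsilon> powr (- K)) powr C" by (simp add: powr_powr)
        also have "\<dots> \<le> (real n * real CARD('d)) powr C"
        proof (intro powr_mono2)
          have "real n * 1 \<le> real n * real CARD('d)" using d by (intro mult_left_mono) auto
          then show "\<epsilon> powr (- K) \<le> real n * real CARD('d)" using n by simp
        qed (use C in auto)
        also have "\<dots> = 2 powr (C * log 2 (real n * real CARD('d)))"
          using n0 d by (simp add: powr_def log_def)
        finally show ?thesis .
      qed
      obtain r where r: "bij_betw r {..<N} (I k)"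
        using ex_bij_betw_nat_finite[OF finI] cardI by (auto simp: atLeast0LessThan)
      define R where "R = (\<lambda>X. map (\<lambda>l. if l < N \<and> r l \<in> X then u (r l) else 0) [0..<n])"
      have lp: "lp_form p (R X) x = (\<Sum>i\<in>X. \<bar>u i \<bullet> x\<bar> powr p)" if "X \<subseteq> I k" for X x
        unfolding R_def by (rule lp_form_subfamily[OF r Nn that])
      have R: "R X \<in> input_matrices C n" if "X \<subseteq> I k" for X
      proof -
        have "u i $ j \<in> \<int> \<and> \<bar>u i $ j\<bar> \<le> 2 powr (C * log 2 (real n * real CARD('d)))" if "i \<in> X" for i j
          using u k0 \<open>X \<subseteq> I k\<close> that kC by (meson order_trans subsetD)
        then show ?thesis by (auto simp: R_def input_matrices_def)
      qed
      have bits: "bits_used D (R X) \<le> enat s" if "X \<subseteq> I k" for X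
      proof -
        have "ereal_of_enat (bits_used D (R X)) < ereal (c * \<epsilon> powr (- (e * real m)))"
          using neg R[OF that] unfolding expo by (auto simp: not_le)
        also have "\<dots> \<le> ereal (real N / 4)" using small by simp
        finally show ?thesis
          by (cases "bits_used D (R X)") (auto simp: s_def le_nat_floor)
      qed
      have gap: "2 * \<epsilon> * card (I k) * (C\<^sub>1 * real k) powr p < c\<^sub>1 * sqrt (real k ^ (CARD('d) - 2))"
      proof -
        define h where "h = real k powr ((real m - 1) / 2)"
        have h: "h > 0" using k0 by (simp add: h_def)
        have sq: "sqrt (real k ^ (CARD('d) - 2)) = h"
          using k0 m by (simp add: h_def powr_half_sqrt[symmetric] powr_realpow[symmetric] powr_powr of_nat_diff)
        have "real N * real k powr p = real k powr (real m + p)"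
          using k0 by (simp add: N_def powr_add powr_realpow)
        also have "real m + p = 1 / e + (real m - 1) / 2" by (simp add: e' field_simps)
        finally have "real N * real k powr p = real k powr (1 / e) * h"
          by (simp only: powr_add h_def)
        then have "2 * \<epsilon> * card (I k) * (C\<^sub>1 * real k) powr p = 2 * (real k powr (1 / e) * \<epsilon>) * C\<^sub>1 powr p * h"
          using C\<^sub>1 by (simp add: cardI powr_mult)
        also have "\<dots> \<le> 2 * \<theta> * C\<^sub>1 powr p * h"
          using k(3) h by (intro mult_right_mono mult_left_mono) auto
        also have "\<dots> = c\<^sub>1 / 2 * h" using C\<^sub>1 by (simp add: \<theta>_def)
        also have "\<dots> < c\<^sub>1 * h" using c\<^sub>1 h by simp
        finally show ?thesis unfolding sq .
      qed
      have sep: "\<exists>x. \<epsilon> * (lp_form p (R X) x + lp_form p (R Y) x) < \<bar>lp_form p (R X) x - lp_form p (R Y) x\<bar>"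
        if XY: "X \<subseteq> I k" "Y \<subseteq> I k" "card (I k) \<le> 16 * card (sym_diff X Y)" for X Y
        unfolding lp[OF XY(1)] lp[OF XY(2)]
      proof (rule lp_sums_separated[OF finI XY _ gap \<epsilon>(1)])
        fix a :: "nat \<times> ('d \<Rightarrow> nat) \<Rightarrow> real"
        assume a: "\<And>i. \<bar>a i\<bar> \<le> 1" "real (card (I k)) / 16 \<le> (\<Sum>i\<in>I k. (a i)\<^sup>2)"
        then obtain x where x: "\<forall>i\<in>I k. \<bar>u i \<bullet> x\<bar> \<le> C\<^sub>1 * real k"
          "c\<^sub>1 * sqrt (real k ^ (CARD('d) - 2)) \<le> \<bar>\<Sum>i\<in>I k. a i * \<bar>u i \<bullet> x\<bar> powr p\<bar>"
          using key k0(2) unfolding cardI N_def by blast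
        have "0 \<le> \<bar>u i \<bullet> x\<bar> powr p \<and> \<bar>u i \<bullet> x\<bar> powr p \<le> (C\<^sub>1 * real k) powr p" if "i \<in> I k" for i
          using x(1) that p by (auto intro!: powr_mono2)
        with x(2) show "\<exists>x. (\<forall>i\<in>I k. 0 \<le> \<bar>u i \<bullet> x\<bar> powr p \<and> \<bar>u i \<bullet> x\<bar> powr p \<le> (C\<^sub>1 * real k) powr p) \<and>
            c\<^sub>1 * sqrt (real k ^ (CARD('d) - 2)) \<le> \<bar>\<Sum>i\<in>I k. a i * \<bar>u i \<bullet> x\<bar> powr p\<bar>" by blast
      qed
      have count: "q * 2 ^ card (I k) \<le> 2 ^ (s + 1) * 2 powr (card (I k) / 2)"
        by (rule solves_subspace_sketch_space_lower_bound[OF D finI R bits sep])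
      \<comment> \<open>Strings account for \<open>N / 4\<close> in the exponent and Hamming balls
        for \<open>N / 2\<close>; the missing \<open>N / 4\<close> would have to be made up by
        \<open>q\<close>.\<close>
      have "q * 2 powr N \<le> 2 * 2 powr (3 * real N / 4)"
      proof -
        have "real s \<le> real N / 4" unfolding s_def by linarith
        then have "2 powr real s \<le> 2 powr (real N / 4)" by (intro powr_mono) auto
        then have "2 * 2 powr real s * 2 powr (N / 2) \<le> 2 * 2 powr (real N / 4) * 2 powr (N / 2)"
          by simp
        also have "\<dots> = 2 * 2 powr (3 * real N / 4)" by (simp flip: powr_add)
        finally show ?thesis using count by (simp add: cardI powr_realpow)
      qed
      also have "2 powr (3 * real N / 4) = 2 powr N * 2 powr (- (real N / 4))"
        by (simp flip: powr_add)
      finally have "q \<le> 2 * 2 powr (- (real N / 4))"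
        by (simp add: mult.left_commute[of 2])
      then have "2 powr (real N / 4) \<le> 2 / q" using q by (simp add: powr_minus field_simps)
      then have "real N / 4 \<le> log 2 (2 / q)" using q by (subst le_log_iff) auto
      moreover have "4 * log 2 (2 / q) < real k\<^sub>1" unfolding k\<^sub>1_def by linarith
      moreover have "real k\<^sub>1 \<le> real N"
      proof -
        have "k ^ 1 \<le> k ^ m" using k0 m by (intro power_increasing) auto
        then show ?thesis using k(1) by (simp add: N_def flip: of_nat_power)
      qed
      ultimately show False by linarith
    qed
  qed
qed

end
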